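(* Let $a_1,a_2\in\mathbb{C}$ be distinct, and set $f=(t-a_1)(t-a_2)\in\mathbb{C}[t]$. If $I=\langle f\rangle$ is the ideal of $\mathbb{C}[t]$ generated by $f$ and $A$ is the subalgebra $\mathbb{C}\oplus I$ of $\mathbb{C}[t]$, then $\dim_{\mathbb{C}}\operatorname{HC}_1(A)=2$.
   Context: For a commutative unital $\mathbb{C}$-algebra $A$, the first cyclic homology is $\operatorname{HC}_1(A)=\Lambda^2(A)/T(A)$, where $\Lambda^2(A)$ is the exterior square of the $\mathbb{C}$-vector space $A$ and $T(A)$ is the subspace spanned by $\{ab\wedge c+bc\wedge a+ca\wedge b: a,b,c\in A\}$. *)

theory Defs
  imports "Jordan_Normal_Form.VS_Connect" "HOL-Algebra.QuotRing"
begin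

text \<open>Vector spaces and algebras are the carrier-based \<^locale>\<open>vectorspace\<close> and \<^locale>\<open>algebra\<close>; the
  dimension is \<^const>\<open>vectorspace.dim\<close>, meaningful under \<^const>\<open>vectorspace.fin_dim\<close>. The record type
  for modules extends the one for rings; its fields \<^const>\<open>mult\<close> and \<^const>\<open>one\<close> play no role in
  \<^locale>\<open>vectorspace\<close> and are filled with a dummy value below.\<close>

definition free_module :: "('k, 'm) ring_scheme \<Rightarrow> 's set \<Rightarrow> ('k, 's \<Rightarrow> 'k) module" where
  "free_module K S = \<lparr>
     carrier = {f. (\<forall>x. f x \<in> carrier K) \<and> finite {x. f x \<noteq> \<zero>\<^bsub>K\<^esub>} \<and> {x. f x \<noteq> \<zero>\<^bsub>K\<^esub>} \<subseteq> S},
     mult = (\<lambda>_ _ _. \<zero>\<^bsub>K\<^esub>), one = (\<lambda>_. \<zero>\<^bsub>K\<^esub>),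
     zero = (\<lambda>_. \<zero>\<^bsub>K\<^esub>), add = (\<lambda>f g x. f x \<oplus>\<^bsub>K\<^esub> g x),
     smult = (\<lambda>c f x. c \<otimes>\<^bsub>K\<^esub> f x)\<rparr>"

definition free_gen :: "('k, 'm) ring_scheme \<Rightarrow> 's \<Rightarrow> 's \<Rightarrow> 'k" where
  "free_gen K s = (\<lambda>x. if x = s then \<one>\<^bsub>K\<^esub> else \<zero>\<^bsub>K\<^esub>)"

definition quot_module :: "('k, 'v, 'm) module_scheme \<Rightarrow> 'v set \<Rightarrow> ('k, 'v set) module" where
  "quot_module M N = \<lparr>
     carrier = a_rcosets\<^bsub>M\<^esub> N,
     mult = (\<lambda>_ _. N), one = N,
     zero = N, add = set_add M,
     smult = (\<lambda>c X. \<Union>x\<in>X. N +>\<^bsub>M\<^esub> (c \<odot>\<^bsub>M\<^esub> x))\<rparr>"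

text \<open>The exterior square is the free vector space on pairs, modulo bilinearity and \<open>v \<and> v = 0\<close>.\<close>

definition ext_square_relations ::
    "('k, 'l) ring_scheme \<Rightarrow> ('k, 'v, 'm) module_scheme \<Rightarrow> ('v \<times> 'v \<Rightarrow> 'k) set" where
  "ext_square_relations K V =
    (let F = free_module K (carrier V \<times> carrier V); e = (\<lambda>u v. free_gen K (u, v)) in
      {e (u \<oplus>\<^bsub>V\<^esub> v) w \<ominus>\<^bsub>F\<^esub> (e u w \<oplus>\<^bsub>F\<^esub> e v w) | u v w.
          u \<in> carrier V \<and> v \<in> carrier V \<and> w \<in> carrier V} \<union>
      {e w (u \<oplus>\<^bsub>V\<^esub> v) \<ominus>\<^bsub>F\<^esub> (e w u \<oplus>\<^bsub>F\<^esub> e w v) | u v w.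
          u \<in> carrier V \<and> v \<in> carrier V \<and> w \<in> carrier V} \<union>
      {e (c \<odot>\<^bsub>V\<^esub> u) v \<ominus>\<^bsub>F\<^esub> c \<odot>\<^bsub>F\<^esub> e u v | c u v.
          c \<in> carrier K \<and> u \<in> carrier V \<and> v \<in> carrier V} \<union>
      {e u (c \<odot>\<^bsub>V\<^esub> v) \<ominus>\<^bsub>F\<^esub> c \<odot>\<^bsub>F\<^esub> e u v | c u v.
          c \<in> carrier K \<and> u \<in> carrier V \<and> v \<in> carrier V} \<union>
      {e v v | v. v \<in> carrier V})"

definition ext_square_kernel ::
    "('k, 'l) ring_scheme \<Rightarrow> ('k, 'v, 'm) module_scheme \<Rightarrow> ('v \<times> 'v \<Rightarrow> 'k) set" where
  "ext_square_kernel K V =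
     LinearCombinations.module.span K (free_module K (carrier V \<times> carrier V)) (ext_square_relations K V)"

definition ext_square ::
    "('k, 'l) ring_scheme \<Rightarrow> ('k, 'v, 'm) module_scheme \<Rightarrow> ('k, ('v \<times> 'v \<Rightarrow> 'k) set) module" where
  "ext_square K V =
     quot_module (free_module K (carrier V \<times> carrier V)) (ext_square_kernel K V)"

definition wedge ::
    "('k, 'l) ring_scheme \<Rightarrow> ('k, 'v, 'm) module_scheme \<Rightarrow> 'v \<Rightarrow> 'v \<Rightarrow> ('v \<times> 'v \<Rightarrow> 'k) set" where
  "wedge K V u v =
     ext_square_kernel K V +>\<^bsub>free_module K (carrier V \<times> carrier V)\<^esub> free_gen K (u, v)"

definition cyclic_relations ::
    "('k, 'l) ring_scheme \<Rightarrow> ('k, 'a, 'm) module_scheme \<Rightarrow> ('a \<times> 'a \<Rightarrow> 'k) set set" where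
  "cyclic_relations K A = LinearCombinations.module.span K (ext_square K A)
     {wedge K A (a \<otimes>\<^bsub>A\<^esub> b) c \<oplus>\<^bsub>ext_square K A\<^esub> wedge K A (b \<otimes>\<^bsub>A\<^esub> c) a
        \<oplus>\<^bsub>ext_square K A\<^esub> wedge K A (c \<otimes>\<^bsub>A\<^esub> a) b | a b c.
        a \<in> carrier A \<and> b \<in> carrier A \<and> c \<in> carrier A}"

definition HC1 ::
    "('k, 'l) ring_scheme \<Rightarrow> ('k, 'a, 'm) module_scheme \<Rightarrow> ('k, ('a \<times> 'a \<Rightarrow> 'k) set set) module" where
  "HC1 K A = quot_module (ext_square K A) (cyclic_relations K A)"

abbreviation complex_field :: "complex ring" where
  "complex_field \<equiv> class_ring"

definition poly_algebra :: "(complex, complex poly) module" where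
  "poly_algebra = \<lparr>carrier = UNIV, mult = (*), one = 1, zero = 0, add = (+), smult = Polynomial.smult\<rparr>"

text \<open>The subspace sum is direct as soon as \<open>I\<close> is a proper ideal.\<close>

definition scalars_plus_ideal :: "complex poly set \<Rightarrow> (complex, complex poly) module" where
  "scalars_plus_ideal I =
     poly_algebra\<lparr>carrier := range (\<lambda>c. [:c:]) <+>\<^bsub>poly_algebra\<^esub> I\<rparr>"

lemma free_module_is_module:
  assumes "cring K"
  shows "module K (free_module K S)"
proof -
  interpret cring K by fact
  let ?F = "free_module K S"
  have ops: "ring.add ?F f g = (\<lambda>x. f x \<oplus>\<^bsub>K\<^esub> g x)" "ring.zero ?F = (\<lambda>_. \<zero>\<^bsub>K\<^esub>)"
    "c \<odot>\<^bsub>?F\<^esub> f = (\<lambda>x. c \<otimes>\<^bsub>K\<^esub> f x)" for f g c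
    by (simp_all add: free_module_def)
  have memI: "f \<in> carrier ?F"
    if "\<And>x. f x \<in> carrier K" "finite T" "{x. f x \<noteq> \<zero>\<^bsub>K\<^esub>} \<subseteq> T" "T \<subseteq> S" for f T
    using that finite_subset[OF that(3,2)] by (simp add: free_module_def)
  have val: "f x \<in> carrier K" if "f \<in> carrier ?F" for f x
    using that by (simp add: free_module_def)
  have supp: "finite {x. f x \<noteq> \<zero>\<^bsub>K\<^esub>}" "{x. f x \<noteq> \<zero>\<^bsub>K\<^esub>} \<subseteq> S" if "f \<in> carrier ?F" for f
    using that by (simp_all add: free_module_def)
  have add: "(\<lambda>x. f x \<oplus>\<^bsub>K\<^esub> g x) \<in> carrier ?F" if "f \<in> carrier ?F" "g \<in> carrier ?F" for f g
    by (rule memI[OF _ finite_UnI[OF supp(1)[OF that(1)] supp(1)[OF that(2)]]])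
       (use supp(2) val that in auto)
  have mult: "(\<lambda>x. c \<otimes>\<^bsub>K\<^esub> f x) \<in> carrier ?F" if "c \<in> carrier K" "f \<in> carrier ?F" for c f
    by (rule memI[OF _ supp(1)[OF that(2)]]) (use supp(2) val that in auto)
  have inv: "(\<lambda>x. \<ominus>\<^bsub>K\<^esub> f x) \<in> carrier ?F" if "f \<in> carrier ?F" for f
    by (rule memI[OF _ supp(1)[OF that]]) (use supp(2) val that in auto)
  have zero: "(\<lambda>_. \<zero>\<^bsub>K\<^esub>) \<in> carrier ?F"
    by (rule memI[of _ "{}"]) auto
  have grp: "abelian_group ?F"
  proof (rule abelian_groupI)
    fix f assume f: "f \<in> carrier ?F"
    show "\<exists>g\<in>carrier ?F. g \<oplus>\<^bsub>?F\<^esub> f = \<zero>\<^bsub>?F\<^esub>"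
      by (rule bexI[OF _ inv[OF f]]) (simp add: ops l_neg val f)
  qed (simp_all add: ops val add zero a_ac)
  show ?thesis
    by (rule moduleI[OF assms grp])
       (simp_all add: ops val add mult l_distr r_distr m_assoc)
qed

lemma free_gen_closed:
  assumes "cring K" and "s \<in> S"
  shows "free_gen K s \<in> carrier (free_module K S)"
proof -
  interpret cring K by fact
  have "{x. free_gen K s x \<noteq> \<zero>\<^bsub>K\<^esub>} \<subseteq> {s}" by (auto simp: free_gen_def)
  with assms(2) show ?thesis
    by (auto simp: free_module_def free_gen_def intro: finite_subset)
qed

lemma quot_module_is_module:
  assumes "module K M" and "submodule K N M"
  shows "module K (quot_module M N)"
proof -
  interpret Module.module K M by fact
  interpret N: LinearCombinations.submodule K N M by fact
  have "\<ominus>\<^bsub>M\<^esub> x \<in> N" if "x \<in> N" for x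
  proof -
    have "(\<ominus>\<^bsub>K\<^esub> \<one>\<^bsub>K\<^esub>) \<odot>\<^bsub>M\<^esub> x \<in> N" using that by simp
    moreover have "x \<in> carrier M" using that N.subset by blast
    ultimately show ?thesis by (simp add: smult_minus_1)
  qed
  then have "subgroup N (add_monoid M)"
    using N.subset by (intro M.add.subgroupI) (auto simp: a_inv_def intro: N.zero_closed)
  then have "abelian_subgroup N M"
    by (intro abelian_subgroupI3 M.abelian_group_axioms additive_subgroup.intro)
  then interpret AS: abelian_subgroup N M .
  have coset: "\<exists>x\<in>carrier M. X = N +>\<^bsub>M\<^esub> x" if "X \<in> a_rcosets\<^bsub>M\<^esub> N" for X
    using that by (auto simp: A_RCOSETS_def' )
  have add: "(N +>\<^bsub>M\<^esub> x) <+>\<^bsub>M\<^esub> (N +>\<^bsub>M\<^esub> y) = N +>\<^bsub>M\<^esub> (x \<oplus>\<^bsub>M\<^esub> y)"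
    if "x \<in> carrier M" "y \<in> carrier M" for x y
    using that by (rule AS.a_rcos_sum)
  have smult: "(\<Union>y\<in>N +>\<^bsub>M\<^esub> x. N +>\<^bsub>M\<^esub> (c \<odot>\<^bsub>M\<^esub> y)) = N +>\<^bsub>M\<^esub> (c \<odot>\<^bsub>M\<^esub> x)"
    if c: "c \<in> carrier K" and x: "x \<in> carrier M" for c x
  proof -
    have "N +>\<^bsub>M\<^esub> (c \<odot>\<^bsub>M\<^esub> y) = N +>\<^bsub>M\<^esub> (c \<odot>\<^bsub>M\<^esub> x)" if "y \<in> N +>\<^bsub>M\<^esub> x" for y
    proof -
      from that obtain n where n: "n \<in> N" "y = n \<oplus>\<^bsub>M\<^esub> x" by (auto simp: a_r_coset_def')
      then have "n \<in> carrier M" using AS.a_subset by auto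
      then have "c \<odot>\<^bsub>M\<^esub> y = c \<odot>\<^bsub>M\<^esub> n \<oplus>\<^bsub>M\<^esub> c \<odot>\<^bsub>M\<^esub> x"
        using n c x by (simp add: smult_r_distr)
      moreover have "c \<odot>\<^bsub>M\<^esub> n \<in> N" using n c by simp
      ultimately have "c \<odot>\<^bsub>M\<^esub> y \<in> N +>\<^bsub>M\<^esub> (c \<odot>\<^bsub>M\<^esub> x)" by (auto simp: a_r_coset_def')
      then show ?thesis using AS.a_repr_independence' c x by (metis smult_closed)
    qed
    moreover have "x \<in> N +>\<^bsub>M\<^esub> x" using x by (rule AS.a_rcos_self)
    ultimately show ?thesis by blast
  qed
  have zero: "N = N +>\<^bsub>M\<^esub> \<zero>\<^bsub>M\<^esub>"
    using AS.a_subset by (auto simp: a_r_coset_def' subset_iff)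
  have mem: "N +>\<^bsub>M\<^esub> x \<in> a_rcosets\<^bsub>M\<^esub> N" if "x \<in> carrier M" for x
    using that by (auto simp: A_RCOSETS_def')
  have grp: "abelian_group (quot_module M N)"
  proof (rule abelian_groupI)
    show "\<zero>\<^bsub>quot_module M N\<^esub> \<in> carrier (quot_module M N)"
      using mem[OF M.zero_closed] zero by (simp add: quot_module_def)
  next
    fix X assume "X \<in> carrier (quot_module M N)"
    then obtain x where x: "x \<in> carrier M" "X = N +>\<^bsub>M\<^esub> x"
      using coset by (auto simp: quot_module_def)
    show "\<exists>Y\<in>carrier (quot_module M N). Y \<oplus>\<^bsub>quot_module M N\<^esub> X = \<zero>\<^bsub>quot_module M N\<^esub>"
      by (rule bexI[of _ "N +>\<^bsub>M\<^esub> (\<ominus>\<^bsub>M\<^esub> x)"])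
         (use x in \<open>auto simp: quot_module_def add mem M.l_neg zero[symmetric]\<close>)
    have "\<zero>\<^bsub>M\<^esub> \<oplus>\<^bsub>M\<^esub> x = x" using x by simp
    then show "\<zero>\<^bsub>quot_module M N\<^esub> \<oplus>\<^bsub>quot_module M N\<^esub> X = X"
      using x add[OF M.zero_closed x(1)] zero by (simp add: quot_module_def)
  qed (auto simp: quot_module_def add mem M.a_ac dest!: coset)
  have car: "\<exists>x\<in>carrier M. X = N +>\<^bsub>M\<^esub> x" if "X \<in> carrier (quot_module M N)" for X
    using that coset by (simp add: quot_module_def)
  have Q: "N +>\<^bsub>M\<^esub> x \<in> carrier (quot_module M N)"
    "(N +>\<^bsub>M\<^esub> x) \<oplus>\<^bsub>quot_module M N\<^esub> (N +>\<^bsub>M\<^esub> y) = N +>\<^bsub>M\<^esub> (x \<oplus>\<^bsub>M\<^esub> y)"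
    "c \<odot>\<^bsub>quot_module M N\<^esub> (N +>\<^bsub>M\<^esub> x) = N +>\<^bsub>M\<^esub> (c \<odot>\<^bsub>M\<^esub> x)"
    if "c \<in> carrier K" "x \<in> carrier M" "y \<in> carrier M" for c x y
    using that by (simp_all add: quot_module_def mem add smult)
  show ?thesis
    by (rule moduleI[OF R.is_cring grp])
       (auto simp: Q smult_l_distr smult_r_distr smult_assoc1 Q(1)[OF R.zero_closed]
             dest!: car)
qed

lemma ext_square_relations_closed:
  assumes "cring K" and "module K V"
  shows "ext_square_relations K V \<subseteq> carrier (free_module K (carrier V \<times> carrier V))"
proof -
  interpret V: Module.module K V by fact
  interpret F: Module.module K "free_module K (carrier V \<times> carrier V)"
    by (rule free_module_is_module) fact
  have "free_gen K (u, v) \<in> carrier (free_module K (carrier V \<times> carrier V))"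
    if "u \<in> carrier V" "v \<in> carrier V" for u v
    using that assms(1) by (intro free_gen_closed) auto
  then show ?thesis
    unfolding ext_square_relations_def Let_def
    by (intro Un_least) (auto intro!: F.M.minus_closed)
qed

lemma ext_square_kernel_submodule:
  assumes "module K V"
  shows "submodule K (ext_square_kernel K V) (free_module K (carrier V \<times> carrier V))"
proof -
  interpret V: Module.module K V by fact
  interpret F: Module.module K "free_module K (carrier V \<times> carrier V)"
    by (rule free_module_is_module) (rule V.R.is_cring)
  show ?thesis
    using F.span_is_submodule[OF ext_square_relations_closed[OF V.R.is_cring assms]]
    by (simp add: ext_square_kernel_def)
qed

lemma ext_square_is_module:
  assumes "module K V"
  shows "module K (ext_square K V)"
proof -
  interpret V: Module.module K V by fact
  show ?thesis
    unfolding ext_square_def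
    by (intro quot_module_is_module free_module_is_module ext_square_kernel_submodule
        V.R.is_cring assms)
qed

lemma wedge_closed:
  assumes "cring K" and "u \<in> carrier V" and "v \<in> carrier V"
  shows "wedge K V u v \<in> carrier (ext_square K V)"
  using free_gen_closed[OF assms(1), of "(u, v)" "carrier V \<times> carrier V"] assms(2,3)
  by (auto simp: wedge_def ext_square_def quot_module_def A_RCOSETS_def')

lemma cyclic_relations_submodule:
  assumes "algebra K A"
  shows "submodule K (cyclic_relations K A) (ext_square K A)"
proof -
  interpret A: algebra K A by fact
  interpret E: Module.module K "ext_square K A"
    by (rule ext_square_is_module) (rule A.module)
  show ?thesis
    unfolding cyclic_relations_def
    by (rule E.span_is_submodule)
       (auto intro!: E.M.add.m_closed wedge_closed A.R_cring)
qed

lemma HC1_is_vectorspace: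
  assumes "field K" and "algebra K A"
  shows "vectorspace K (HC1 K A)"
proof -
  interpret A: algebra K A by fact
  show ?thesis
    unfolding HC1_def vectorspace_def
    by (intro conjI quot_module_is_module ext_square_is_module cyclic_relations_submodule
        A.module assms)
qed

lemma poly_algebra_is_algebra: "algebra complex_field poly_algebra"
proof (rule algebraI)
  show "cring complex_field"
    by (rule class_cring.is_cring)
  show "cring poly_algebra"
  proof (intro cringI abelian_groupI comm_monoidI)
    fix p assume "p \<in> carrier poly_algebra"
    show "\<exists>q\<in>carrier poly_algebra. q \<oplus>\<^bsub>poly_algebra\<^esub> p = \<zero>\<^bsub>poly_algebra\<^esub>"
      by (rule bexI[of _ "- p"]) (simp_all add: poly_algebra_def)
  qed (simp_all add: poly_algebra_def algebra_simps)
qed (simp_all add: poly_algebra_def smult_add_left smult_add_right)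

lemma scalars_plus_ideal_is_algebra:
  assumes "ideal I poly_algebra"
  shows "algebra complex_field (scalars_plus_ideal I)"
proof -
  interpret I: ideal I poly_algebra by fact
  have zero: "0 \<in> I" using I.additive_subgroup_axioms additive_subgroup.zero_closed by (fastforce simp add: poly_algebra_def)
  have add: "p + q \<in> I" if "p \<in> I" "q \<in> I" for p q
    using additive_subgroup.a_closed[OF I.additive_subgroup_axioms that] by (simp add: poly_algebra_def)
  have mult: "p * q \<in> I" if "q \<in> I" for p q
    using I.I_l_closed[OF that, of p] by (simp add: poly_algebra_def)
  have car: "carrier (scalars_plus_ideal I) = {[:c:] + p | c p. p \<in> I}"
    by (auto simp: scalars_plus_ideal_def set_add_def' poly_algebra_def)
  have memI: "[:c:] + p \<in> carrier (scalars_plus_ideal I)" if "p \<in> I" for c p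
    using that by (auto simp: car)
  have ops: "mult (scalars_plus_ideal I) = (*)" "one (scalars_plus_ideal I) = 1"
    "ring.zero (scalars_plus_ideal I) = 0" "ring.add (scalars_plus_ideal I) = (+)"
    "module.smult (scalars_plus_ideal I) = Polynomial.smult"
    by (simp_all add: scalars_plus_ideal_def poly_algebra_def)
  have add_c: "x + y \<in> carrier (scalars_plus_ideal I)"
    if "x \<in> carrier (scalars_plus_ideal I)" "y \<in> carrier (scalars_plus_ideal I)" for x y
  proof -
    from that obtain c p d q where "x = [:c:] + p" "y = [:d:] + q" "p \<in> I" "q \<in> I"
      by (auto simp: car)
    then show ?thesis using memI[OF add, of p q "c + d"] by (simp add: algebra_simps)
  qed
  have mult_c: "x * y \<in> carrier (scalars_plus_ideal I)"
    if "x \<in> carrier (scalars_plus_ideal I)" "y \<in> carrier (scalars_plus_ideal I)" for x y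
  proof -
    from that obtain c p d q where xy: "x = [:c:] + p" "y = [:d:] + q" and pq: "p \<in> I" "q \<in> I"
      by (auto simp: car)
    have "x * y = [:c * d:] + ([:c:] * q + ([:d:] * p + p * q))"
      by (simp add: xy algebra_simps)
    moreover have "[:c:] * q + ([:d:] * p + p * q) \<in> I" using pq by (intro add mult)
    ultimately show ?thesis using memI by metis
  qed
  have const_c: "[:c:] \<in> carrier (scalars_plus_ideal I)" for c
    using memI[OF zero, of c] by simp
  have one_c: "1 \<in> carrier (scalars_plus_ideal I)"
    using const_c[of 1] by (simp add: one_pCons)
  have zero_c: "0 \<in> carrier (scalars_plus_ideal I)"
    using const_c[of 0] by simp
  have smult_c: "Polynomial.smult c x \<in> carrier (scalars_plus_ideal I)"
    if "x \<in> carrier (scalars_plus_ideal I)" for c x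
    using mult_c[OF const_c that, of c] by simp
  show ?thesis
  proof (rule algebraI)
    show "cring complex_field"
      by (rule class_cring.is_cring)
    show "cring (scalars_plus_ideal I)"
    proof (intro cringI abelian_groupI comm_monoidI)
      fix p assume "p \<in> carrier (scalars_plus_ideal I)"
      then have "- p \<in> carrier (scalars_plus_ideal I)"
        using smult_c[of p "-1"] by simp
      then show "\<exists>q\<in>carrier (scalars_plus_ideal I).
          q \<oplus>\<^bsub>scalars_plus_ideal I\<^esub> p = \<zero>\<^bsub>scalars_plus_ideal I\<^esub>"
        by (intro bexI[of _ "- p"]) (simp_all add: ops)
    qed (simp_all add: ops add_c mult_c one_c zero_c algebra_simps)
  qed (simp_all add: ops smult_c smult_add_left smult_add_right)
qed

end

theory Submission
  imports Defs
begin

text \<open>A class in \<open>HC\<^sub>1(A)\<close> behaves like a one-form modulo exact forms, where \<open>a \<and> b\<close> stands for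
  \<open>a db\<close>. With \<open>x = t - (a\<^sub>1 + a\<^sub>2)/2\<close>, \<open>u = f\<close>, \<open>v = x f\<close> and \<open>e = ((a\<^sub>2 - a\<^sub>1)/2)\<^sup>2\<close> the algebra
  \<open>A\<close> is spanned by all \<open>u\<^sup>k\<close> and \<open>u\<^sup>k v\<close>, and \<open>v\<^sup>2 = u\<^sup>3 + e u\<^sup>2\<close> (a nodal cubic). The Leibniz-type
  rule \<open>ab \<and> c = a \<and> bc + b \<and> ca\<close> reduces every class to the classes \<open>w\<^sub>k = u \<and> u\<^sup>k v\<close>, and evaluating
  \<open>v\<^sup>2 \<and> u\<^sup>k v\<close> in two ways gives \<open>(2k + 9) w\<^bsub>k+2\<^esub> + 2e(k + 3) w\<^bsub>k+1\<^esub> = 0\<close>. So \<open>w\<^sub>0\<close> and \<open>w\<^sub>1\<close> span.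
  They are independent because of two functionals: the integral of \<open>p dq\<close> from \<open>a\<^sub>1\<close> to \<open>a\<^sub>2\<close> (closed up
  to a loop at the node), nonzero on \<open>w\<^sub>1\<close>, and \<open>p'(a\<^sub>1) q'(a\<^sub>2) - p'(a\<^sub>2) q'(a\<^sub>1)\<close>, which detects
  the torsion at the node: it is nonzero on \<open>w\<^sub>0\<close> and vanishes on \<open>w\<^sub>1\<close>.\<close>

section \<open>Quotients and free modules\<close>

lemma submodule_abelian_subgroup:
  assumes "submodule K N M"
  shows "abelian_subgroup N M"
proof -
  interpret N: LinearCombinations.submodule K N M by fact
  interpret Module.module K M by (rule N.module)
  have "\<ominus>\<^bsub>M\<^esub> x \<in> N" if "x \<in> N" for x
  proof -
    have "(\<ominus>\<^bsub>K\<^esub> \<one>\<^bsub>K\<^esub>) \<odot>\<^bsub>M\<^esub> x \<in> N" using that by simp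
    moreover have "x \<in> carrier M" using that N.subset by blast
    ultimately show ?thesis by (simp add: smult_minus_1)
  qed
  then have "subgroup N (add_monoid M)"
    using N.subset by (intro M.add.subgroupI) (auto simp: a_inv_def intro: N.zero_closed)
  then show ?thesis
    by (intro abelian_subgroupI3 M.abelian_group_axioms additive_subgroup.intro)
qed

lemma quot_module_carrier:
  "carrier (quot_module M N) = (\<lambda>x. N +>\<^bsub>M\<^esub> x) ` carrier M"
  by (auto simp: quot_module_def A_RCOSETS_def')

lemma quot_module_proj:
  assumes "submodule K N M"
  shows "mod_hom K M (quot_module M N) (\<lambda>x. N +>\<^bsub>M\<^esub> x)"
proof -
  interpret N: LinearCombinations.submodule K N M by fact
  interpret Module.module K M by (rule N.module)
  interpret AS: abelian_subgroup N M by (rule submodule_abelian_subgroup) fact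
  \<comment> \<open>The scalar action on a quotient is a union over all representatives. Every
    member of the union is the same coset, since \<open>c\<close> times an element of
    \<open>N\<close> stays in \<open>N\<close>.\<close>
  have smult: "(\<Union>y\<in>N +>\<^bsub>M\<^esub> x. N +>\<^bsub>M\<^esub> (c \<odot>\<^bsub>M\<^esub> y)) = N +>\<^bsub>M\<^esub> (c \<odot>\<^bsub>M\<^esub> x)"
    if c: "c \<in> carrier K" and x: "x \<in> carrier M" for c x
  proof -
    have "N +>\<^bsub>M\<^esub> (c \<odot>\<^bsub>M\<^esub> y) = N +>\<^bsub>M\<^esub> (c \<odot>\<^bsub>M\<^esub> x)" if "y \<in> N +>\<^bsub>M\<^esub> x" for y
    proof -
      from that obtain n where n: "n \<in> N" "y = n \<oplus>\<^bsub>M\<^esub> x" by (auto simp: a_r_coset_def')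
      then have "c \<odot>\<^bsub>M\<^esub> y = c \<odot>\<^bsub>M\<^esub> n \<oplus>\<^bsub>M\<^esub> c \<odot>\<^bsub>M\<^esub> x"
        using c x N.subset by (auto simp: smult_r_distr)
      moreover have "c \<odot>\<^bsub>M\<^esub> n \<in> N" using n c by simp
      ultimately have "c \<odot>\<^bsub>M\<^esub> y \<in> N +>\<^bsub>M\<^esub> (c \<odot>\<^bsub>M\<^esub> x)" by (auto simp: a_r_coset_def')
      then show ?thesis using AS.a_repr_independence' c x by (metis smult_closed)
    qed
    moreover have "x \<in> N +>\<^bsub>M\<^esub> x" using x by (rule AS.a_rcos_self)
    ultimately show ?thesis by blast
  qed
  show ?thesis
  proof (intro mod_hom.intro mod_hom_axioms.intro)
    show "module K (quot_module M N)"
      using N.module assms by (rule quot_module_is_module)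
    show "(\<lambda>x. N +>\<^bsub>M\<^esub> x) \<in> LinearCombinations.module_hom K M (quot_module M N)"
      unfolding LinearCombinations.module_hom_def
      by (auto simp: quot_module_carrier smult AS.a_rcos_sum)
         (auto simp: quot_module_def smult AS.a_rcos_sum)
  qed (rule N.module)
qed

lemma quot_module_coset_eq_zero:
  assumes "submodule K N M" and "x \<in> N"
  shows "N +>\<^bsub>M\<^esub> x = \<zero>\<^bsub>quot_module M N\<^esub>"
proof -
  interpret AS: abelian_subgroup N M by (rule submodule_abelian_subgroup) fact
  show ?thesis
    using assms(2) by (simp add: quot_module_def AS.a_rcos_const)
qed

text \<open>Every element is a finite combination of generators. In this form a property of all
  elements follows once it is closed under linear operations and holds on generators.\<close>

lemma free_module_generated:
  assumes "cring K" and sub: "submodule K X (free_module K S)"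
    and gen: "\<And>s. s \<in> S \<Longrightarrow> free_gen K s \<in> X"
  shows "X = carrier (free_module K S)"
proof
  interpret X: LinearCombinations.submodule K X "free_module K S" by fact
  interpret cring K by fact
  show "X \<subseteq> carrier (free_module K S)" by (rule X.subset)
  \<comment> \<open>Induction on a finite bound \<open>T\<close> for the support rather than on the
    support itself, which cancellation may shrink.\<close>
  have "f \<in> X" if "finite T" "f \<in> carrier (free_module K S)" "{x. f x \<noteq> \<zero>\<^bsub>K\<^esub>} \<subseteq> T" "T \<subseteq> S" for T f
    using that
  proof (induction T arbitrary: f rule: finite_induct)
    case empty
    then have "f = \<zero>\<^bsub>free_module K S\<^esub>" by (auto simp: free_module_def)
    then show ?case using X.zero_closed by simp
  next
    case (insert t T)
    \<comment> \<open>Erasing the value at \<open>t\<close> leaves support in \<open>T\<close>; the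
      erased part is \<open>f t\<close> times one generator.\<close>
    let ?g = "f(t := \<zero>\<^bsub>K\<^esub>)"
    have val: "f x \<in> carrier K" for x using insert.prems by (simp add: free_module_def)
    have "{x. ?g x \<noteq> \<zero>\<^bsub>K\<^esub>} \<subseteq> {x. f x \<noteq> \<zero>\<^bsub>K\<^esub>}" by auto
    then have "?g \<in> carrier (free_module K S)"
      using insert.prems by (auto simp: free_module_def intro: finite_subset)
    moreover have "{x. ?g x \<noteq> \<zero>\<^bsub>K\<^esub>} \<subseteq> T" using insert.prems by auto
    ultimately have "?g \<in> X" using insert.IH insert.prems by blast
    moreover have "f t \<odot>\<^bsub>free_module K S\<^esub> free_gen K t \<in> X"
      using gen insert.prems val by (intro X.smult_closed) auto
    moreover have "f = ?g \<oplus>\<^bsub>free_module K S\<^esub> f t \<odot>\<^bsub>free_module K S\<^esub> free_gen K t"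
      using val by (auto simp: free_module_def free_gen_def)
    ultimately show ?case using X.m_closed by metis
  qed
  then show "carrier (free_module K S) \<subseteq> X" by (auto simp: free_module_def)
qed

lemma quot_module_coset_eqI:
  assumes "submodule K N M" and "x \<in> carrier M" and "y \<in> carrier M" and "x \<ominus>\<^bsub>M\<^esub> y \<in> N"
  shows "N +>\<^bsub>M\<^esub> x = N +>\<^bsub>M\<^esub> y"
proof -
  interpret h: mod_hom K M "quot_module M N" "\<lambda>x. N +>\<^bsub>M\<^esub> x"
    by (rule quot_module_proj) fact
  have d: "x \<ominus>\<^bsub>M\<^esub> y \<in> carrier M" using assms by (simp add: h.M.M.minus_closed)
  have "x = (x \<ominus>\<^bsub>M\<^esub> y) \<oplus>\<^bsub>M\<^esub> y"
    using assms by (simp add: a_minus_def h.M.M.a_assoc h.M.M.l_neg)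
  then have "N +>\<^bsub>M\<^esub> x = (N +>\<^bsub>M\<^esub> (x \<ominus>\<^bsub>M\<^esub> y)) \<oplus>\<^bsub>quot_module M N\<^esub> (N +>\<^bsub>M\<^esub> y)"
    using h.f_add[OF d assms(3)] by simp
  then show ?thesis
    using assms(3) h.N.M.l_zero[OF h.f_im[OF assms(3)]]
    by (simp add: quot_module_coset_eq_zero[OF assms(1,4)])
qed

section \<open>Universal properties of quotients and of free modules\<close>

lemma quot_module_lift:
  assumes "submodule K N M" and "mod_hom K M W h" and ker: "\<And>x. x \<in> N \<Longrightarrow> h x = \<zero>\<^bsub>W\<^esub>"
  obtains g where "mod_hom K (quot_module M N) W g"
    and "\<And>x. x \<in> carrier M \<Longrightarrow> g (N +>\<^bsub>M\<^esub> x) = h x"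
proof -
  interpret h: mod_hom K M W h by fact
  interpret N: LinearCombinations.submodule K N M by fact
  interpret p: mod_hom K M "quot_module M N" "\<lambda>x. N +>\<^bsub>M\<^esub> x"
    by (rule quot_module_proj) fact
  interpret AS: abelian_subgroup N M by (rule submodule_abelian_subgroup) fact
  \<comment> \<open>Any representative will do: two of them differ by an element of
    \<open>N\<close>, which \<open>h\<close> kills.\<close>
  define g where "g X = h (SOME x. x \<in> X)" for X
  have g: "g (N +>\<^bsub>M\<^esub> x) = h x" if x: "x \<in> carrier M" for x
  proof -
    have "(SOME y. y \<in> N +>\<^bsub>M\<^esub> x) \<in> N +>\<^bsub>M\<^esub> x"
      using AS.a_rcos_self[OF x] by (rule someI)
    then obtain n where n: "n \<in> N" "(SOME y. y \<in> N +>\<^bsub>M\<^esub> x) = n \<oplus>\<^bsub>M\<^esub> x"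
      by (auto simp: a_r_coset_def')
    then show ?thesis using x ker N.subset by (auto simp: g_def)
  qed
  have "g \<in> LinearCombinations.module_hom K (quot_module M N) W"
    unfolding LinearCombinations.module_hom_def
    by (auto simp: quot_module_carrier g simp flip: p.f_add p.f_smult)
  then have "mod_hom K (quot_module M N) W g"
    by (intro mod_hom.intro mod_hom_axioms.intro p.N.module_axioms h.N.module_axioms)
  then show ?thesis using g by (rule that)
qed

lemma free_module_lift:
  assumes "module K W" and b: "\<And>s. s \<in> S \<Longrightarrow> b s \<in> carrier W"
  obtains h where "mod_hom K (free_module K S) W h"
    and "\<And>s. s \<in> S \<Longrightarrow> h (free_gen K s) = b s"
proof -
  interpret W: Module.module K W by fact
  interpret F: Module.module K "free_module K S"
    by (rule free_module_is_module) (rule W.R.is_cring)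
  define h where "h f = (\<Oplus>\<^bsub>W\<^esub>s\<in>{x. f x \<noteq> \<zero>\<^bsub>K\<^esub>}. f s \<odot>\<^bsub>W\<^esub> b s)" for f
  have val: "f x \<in> carrier K" if "f \<in> carrier (free_module K S)" for f x
    using that by (simp add: free_module_def)
  have supp: "finite {x. f x \<noteq> \<zero>\<^bsub>K\<^esub>}" "{x. f x \<noteq> \<zero>\<^bsub>K\<^esub>} \<subseteq> S" if "f \<in> carrier (free_module K S)" for f
    using that by (simp_all add: free_module_def)
  \<comment> \<open>The index set may grow to any finite \<open>T\<close> in \<open>S\<close>, as
    the added terms are zero. So \<open>f\<close>, \<open>g\<close>, their sum and multiples of
    \<open>f\<close> can be summed over one common set below.\<close>
  have h: "h f = (\<Oplus>\<^bsub>W\<^esub>s\<in>T. f s \<odot>\<^bsub>W\<^esub> b s)"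
    if "f \<in> carrier (free_module K S)" "finite T" "{x. f x \<noteq> \<zero>\<^bsub>K\<^esub>} \<subseteq> T" "T \<subseteq> S" for f T
    unfolding h_def
  proof (rule W.M.add.finprod_mono_neutral_cong_left)
    fix i assume "i \<in> T - {x. f x \<noteq> \<zero>\<^bsub>K\<^esub>}"
    then show "f i \<odot>\<^bsub>W\<^esub> b i = \<zero>\<^bsub>W\<^esub>" using that b by auto
  qed (use that b val in auto)
  have "h \<in> LinearCombinations.module_hom K (free_module K S) W"
    unfolding LinearCombinations.module_hom_def
  proof (intro CollectI conjI allI impI funcsetI; (elim conjE)?)
    fix f assume f: "f \<in> carrier (free_module K S)"
    then show "h f \<in> carrier W" using val b supp[OF f] unfolding h_def
      by (intro W.M.finsum_closed) auto
    fix c assume c: "c \<in> carrier K"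
    let ?T = "{x. f x \<noteq> \<zero>\<^bsub>K\<^esub>}"
    have cf: "c \<odot>\<^bsub>free_module K S\<^esub> f = (\<lambda>x. c \<otimes>\<^bsub>K\<^esub> f x)" by (simp add: free_module_def)
    have "h (c \<odot>\<^bsub>free_module K S\<^esub> f) = (\<Oplus>\<^bsub>W\<^esub>s\<in>?T. (c \<otimes>\<^bsub>K\<^esub> f s) \<odot>\<^bsub>W\<^esub> b s)"
      by (subst h[of _ ?T]) (use f c supp[OF f] in \<open>auto simp: cf intro: F.smult_closed[OF c f, unfolded cf]\<close>)
    also have "\<dots> = (\<Oplus>\<^bsub>W\<^esub>s\<in>?T. c \<odot>\<^bsub>W\<^esub> (f s \<odot>\<^bsub>W\<^esub> b s))"
      using c val[OF f] b supp[OF f] by (intro W.M.finsum_cong') (auto simp: W.smult_assoc1)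
    also have "\<dots> = c \<odot>\<^bsub>W\<^esub> h f"
      unfolding h_def
      using c val[OF f] b supp[OF f] by (intro W.finsum_smult[symmetric]) auto
    finally show "h (c \<odot>\<^bsub>free_module K S\<^esub> f) = c \<odot>\<^bsub>W\<^esub> h f" .
  next
    fix f g assume f: "f \<in> carrier (free_module K S)" and g: "g \<in> carrier (free_module K S)"
    let ?T = "{x. f x \<noteq> \<zero>\<^bsub>K\<^esub>} \<union> {x. g x \<noteq> \<zero>\<^bsub>K\<^esub>}"
    have T: "finite ?T" "?T \<subseteq> S" using supp[OF f] supp[OF g] by auto
    have fg: "f \<oplus>\<^bsub>free_module K S\<^esub> g = (\<lambda>x. f x \<oplus>\<^bsub>K\<^esub> g x)" by (simp add: free_module_def)
    have "h (f \<oplus>\<^bsub>free_module K S\<^esub> g) = (\<Oplus>\<^bsub>W\<^esub>s\<in>?T. (f s \<oplus>\<^bsub>K\<^esub> g s) \<odot>\<^bsub>W\<^esub> b s)"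
      by (subst h[of _ ?T]) (use T f g in \<open>auto simp: fg intro: F.M.add.m_closed[OF f g, unfolded fg]\<close>)
    also have "\<dots> = (\<Oplus>\<^bsub>W\<^esub>s\<in>?T. f s \<odot>\<^bsub>W\<^esub> b s \<oplus>\<^bsub>W\<^esub> g s \<odot>\<^bsub>W\<^esub> b s)"
      using val[OF f] val[OF g] b T by (intro W.M.finsum_cong') (auto simp: W.smult_l_distr)
    also have "\<dots> = h f \<oplus>\<^bsub>W\<^esub> h g"
      by (subst h[OF f T(1) _ T(2)], simp, subst h[OF g T(1) _ T(2)], simp, rule W.M.finsum_addf)
        (use val[OF f] val[OF g] b T in auto)
    finally show "h (f \<oplus>\<^bsub>free_module K S\<^esub> g) = h f \<oplus>\<^bsub>W\<^esub> h g" .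
  qed
  then have "mod_hom K (free_module K S) W h"
    by (intro mod_hom.intro mod_hom_axioms.intro F.module_axioms W.module_axioms)
  moreover have "h (free_gen K s) = b s" if s: "s \<in> S" for s
  proof -
    have "h (free_gen K s) = (\<Oplus>\<^bsub>W\<^esub>x\<in>{s}. free_gen K s x \<odot>\<^bsub>W\<^esub> b x)"
      by (rule h[OF free_gen_closed[OF W.R.is_cring s]]) (use s in \<open>auto simp: free_gen_def\<close>)
    then show ?thesis using s b by (simp add: free_gen_def)
  qed
  ultimately show ?thesis by (rule that)
qed

section \<open>The bracket on first cyclic homology\<close>

definition HC1_class ::
    "('k, 'l) ring_scheme \<Rightarrow> ('k, 'a, 'm) module_scheme \<Rightarrow> 'a \<Rightarrow> 'a \<Rightarrow> ('a \<times> 'a \<Rightarrow> 'k) set set" where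
  "HC1_class K A a b = cyclic_relations K A +>\<^bsub>ext_square K A\<^esub> wedge K A a b"

text \<open>These are the bilinear alternating maps that kill the cyclic sums. They factor through
  HC_1 by \<open>HC1_lift\<close>, and \<open>HC1_class\<close> is itself one, so the locale serves
  both to calculate in HC_1 and to define functionals on it.\<close>

locale cyclic_bracket = A: algebra K A + M: Module.module K M
  for K and A and M +
  fixes b
  assumes b_closed [simp, intro]: "\<lbrakk>x \<in> carrier A; y \<in> carrier A\<rbrakk> \<Longrightarrow> b x y \<in> carrier M"
    and b_add_left: "\<lbrakk>x \<in> carrier A; y \<in> carrier A; z \<in> carrier A\<rbrakk> \<Longrightarrow>
      b (x \<oplus>\<^bsub>A\<^esub> y) z = b x z \<oplus>\<^bsub>M\<^esub> b y z"
    and b_add_right: "\<lbrakk>x \<in> carrier A; y \<in> carrier A; z \<in> carrier A\<rbrakk> \<Longrightarrow>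
      b z (x \<oplus>\<^bsub>A\<^esub> y) = b z x \<oplus>\<^bsub>M\<^esub> b z y"
    and b_smult_left: "\<lbrakk>c \<in> carrier K; x \<in> carrier A; y \<in> carrier A\<rbrakk> \<Longrightarrow>
      b (c \<odot>\<^bsub>A\<^esub> x) y = c \<odot>\<^bsub>M\<^esub> b x y"
    and b_smult_right: "\<lbrakk>c \<in> carrier K; x \<in> carrier A; y \<in> carrier A\<rbrakk> \<Longrightarrow>
      b x (c \<odot>\<^bsub>A\<^esub> y) = c \<odot>\<^bsub>M\<^esub> b x y"
    and b_self: "x \<in> carrier A \<Longrightarrow> b x x = \<zero>\<^bsub>M\<^esub>"
    and b_cyclic: "\<lbrakk>x \<in> carrier A; y \<in> carrier A; z \<in> carrier A\<rbrakk> \<Longrightarrow>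
      b (x \<otimes>\<^bsub>A\<^esub> y) z \<oplus>\<^bsub>M\<^esub> b (y \<otimes>\<^bsub>A\<^esub> z) x \<oplus>\<^bsub>M\<^esub> b (z \<otimes>\<^bsub>A\<^esub> x) y = \<zero>\<^bsub>M\<^esub>"

context cyclic_bracket
begin

text \<open>Polarization: expand the bracket of \<open>x + y\<close> with itself.\<close>

lemma b_swap:
  assumes "x \<in> carrier A" and "y \<in> carrier A"
  shows "b y x = \<ominus>\<^bsub>M\<^esub> b x y"
proof -
  have "b (x \<oplus>\<^bsub>A\<^esub> y) (x \<oplus>\<^bsub>A\<^esub> y) = \<zero>\<^bsub>M\<^esub>"
    using assms by (intro b_self) simp
  moreover have "b (x \<oplus>\<^bsub>A\<^esub> y) (x \<oplus>\<^bsub>A\<^esub> y) = b x y \<oplus>\<^bsub>M\<^esub> b y x"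
    using assms by (subst b_add_left) (simp_all add: b_add_right b_self)
  ultimately have "b y x \<oplus>\<^bsub>M\<^esub> b x y = \<zero>\<^bsub>M\<^esub>"
    using assms by (simp add: M.M.a_comm)
  then show ?thesis using assms by (simp add: M.M.minus_equality)
qed

text \<open>The cyclic relation with two terms moved to the other side, where antisymmetry absorbs
  the sign. It carries a product from the left slot to the right one, as every later reduction
  requires.\<close>

lemma b_mult_left:
  assumes "x \<in> carrier A" and "y \<in> carrier A" and "z \<in> carrier A"
  shows "b (x \<otimes>\<^bsub>A\<^esub> y) z = b x (y \<otimes>\<^bsub>A\<^esub> z) \<oplus>\<^bsub>M\<^esub> b y (z \<otimes>\<^bsub>A\<^esub> x)"
proof -
  have "b (x \<otimes>\<^bsub>A\<^esub> y) z \<oplus>\<^bsub>M\<^esub> (b (y \<otimes>\<^bsub>A\<^esub> z) x \<oplus>\<^bsub>M\<^esub> b (z \<otimes>\<^bsub>A\<^esub> x) y) = \<zero>\<^bsub>M\<^esub>"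
    using b_cyclic[OF assms] assms by (simp add: M.M.a_assoc)
  then have "b (x \<otimes>\<^bsub>A\<^esub> y) z = \<ominus>\<^bsub>M\<^esub> (b (y \<otimes>\<^bsub>A\<^esub> z) x \<oplus>\<^bsub>M\<^esub> b (z \<otimes>\<^bsub>A\<^esub> x) y)"
    using assms by (simp add: M.M.minus_equality)
  then show ?thesis
    using assms b_swap[of x "y \<otimes>\<^bsub>A\<^esub> z"] b_swap[of y "z \<otimes>\<^bsub>A\<^esub> x"]
    by (simp add: M.M.minus_add)
qed

text \<open>The form 1 dx is exact. Formally, the product rule for 1 = 1 * 1 gives m = m +
  m.\<close>

lemma b_one_left:
  assumes "x \<in> carrier A"
  shows "b \<one>\<^bsub>A\<^esub> x = \<zero>\<^bsub>M\<^esub>"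
proof -
  have "b \<one>\<^bsub>A\<^esub> x = b \<one>\<^bsub>A\<^esub> x \<oplus>\<^bsub>M\<^esub> b \<one>\<^bsub>A\<^esub> x"
    using b_mult_left[of "\<one>\<^bsub>A\<^esub>" "\<one>\<^bsub>A\<^esub>" x] assms by simp
  then show ?thesis using assms by (simp add: M.M.add.r_cancel_one')
qed

text \<open>The bracket extends linearly to the free module, then descends twice: to the exterior
  square and to HC_1. Each time the generating relations lie in the kernel, a submodule, which
  therefore contains their span.\<close>

lemma HC1_lift:
  obtains g where "mod_hom K (HC1 K A) M g"
    and "\<And>x y. \<lbrakk>x \<in> carrier A; y \<in> carrier A\<rbrakk> \<Longrightarrow> g (HC1_class K A x y) = b x y"
proof -
  let ?F = "free_module K (carrier A \<times> carrier A)"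
  let ?E = "ext_square K A"
  have cring: "cring K" by (rule A.R_cring)
  have FM: "module K ?F" by (rule free_module_is_module) fact
  obtain h where h: "mod_hom K ?F M h"
    and h_s: "\<And>s. s \<in> carrier A \<times> carrier A \<Longrightarrow> h (free_gen K s) = b (fst s) (snd s)"
    by (rule free_module_lift[OF M.module_axioms, of "carrier A \<times> carrier A" "\<lambda>s. b (fst s) (snd s)"])
      (auto simp: b_closed)
  have h_gen: "h (free_gen K (x, y)) = b x y" if "x \<in> carrier A" "y \<in> carrier A" for x y
    using h_s[of "(x, y)"] that by simp
  interpret h: mod_hom K ?F M h by fact
  have fg: "free_gen K (x, y) \<in> carrier ?F" if "x \<in> carrier A" "y \<in> carrier A" for x y
    using that cring by (intro free_gen_closed) auto
  have "ext_square_relations K A \<subseteq> h.ker"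
    unfolding ext_square_relations_def Let_def h.ker_def
    by (auto simp: fg h_gen b_add_left b_add_right b_smult_left b_smult_right b_self
        intro!: h.M.M.minus_closed)
  then have "ext_square_kernel K A \<subseteq> h.ker"
    unfolding ext_square_kernel_def by (rule h.M.span_is_subset) (rule h.ker_is_submodule)
  then have "h x = \<zero>\<^bsub>M\<^esub>" if "x \<in> ext_square_kernel K A" for x
    using that by (auto simp: h.ker_def)
  from quot_module_lift[OF ext_square_kernel_submodule[OF A.module] h this]
  obtain g where g: "mod_hom K ?E M g"
    and gh: "\<And>x. x \<in> carrier ?F \<Longrightarrow> g (ext_square_kernel K A +>\<^bsub>?F\<^esub> x) = h x"
    unfolding ext_square_def by metis
  interpret g: mod_hom K ?E M g by fact
  have gw: "g (wedge K A x y) = b x y" if "x \<in> carrier A" "y \<in> carrier A" for x y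
    using that by (simp add: wedge_def gh fg h_gen)
  have wc: "wedge K A x y \<in> carrier ?E" if "x \<in> carrier A" "y \<in> carrier A" for x y
    using that cring by (intro wedge_closed)
  have "cyclic_relations K A \<subseteq> g.ker"
    unfolding cyclic_relations_def
    by (rule g.M.span_is_subset[OF _ g.ker_is_submodule]) (auto simp: g.ker_def wc gw b_cyclic)
  then have "g x = \<zero>\<^bsub>M\<^esub>" if "x \<in> cyclic_relations K A" for x
    using that by (auto simp: g.ker_def)
  from quot_module_lift[OF cyclic_relations_submodule[OF A.algebra_axioms] g this]
  obtain k where k: "mod_hom K (HC1 K A) M k"
    and kg: "\<And>x. x \<in> carrier ?E \<Longrightarrow> k (cyclic_relations K A +>\<^bsub>?E\<^esub> x) = g x"
    unfolding HC1_def by metis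
  show ?thesis by (rule that[OF k]) (simp add: HC1_class_def wc gw kg)
qed

end

lemma cyclic_bracket_HC1_class:
  assumes "algebra K A"
  shows "cyclic_bracket K A (HC1 K A) (HC1_class K A)"
proof -
  let ?F = "free_module K (carrier A \<times> carrier A)"
  let ?E = "ext_square K A"
  interpret A: algebra K A by fact
  have cring: "cring K" by (rule A.R_cring)
  have FM: "module K ?F" by (rule free_module_is_module) fact
  have sub1: "submodule K (ext_square_kernel K A) ?F"
    by (rule ext_square_kernel_submodule) (rule A.module)
  have sub2: "submodule K (cyclic_relations K A) ?E"
    by (rule cyclic_relations_submodule) fact
  interpret p: mod_hom K ?F ?E "\<lambda>x. ext_square_kernel K A +>\<^bsub>?F\<^esub> x"
    using quot_module_proj[OF sub1] by (simp add: ext_square_def)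
  interpret q: mod_hom K ?E "HC1 K A" "\<lambda>x. cyclic_relations K A +>\<^bsub>?E\<^esub> x"
    using quot_module_proj[OF sub2] by (simp add: HC1_def)
  have fg: "free_gen K (x, y) \<in> carrier ?F" if "x \<in> carrier A" "y \<in> carrier A" for x y
    using that cring by (intro free_gen_closed) auto
  have wc: "wedge K A x y \<in> carrier ?E" if "x \<in> carrier A" "y \<in> carrier A" for x y
    using that cring by (intro wedge_closed)
  have rel: "x \<in> ext_square_kernel K A" if "x \<in> ext_square_relations K A" for x
    using p.M.in_own_span[OF ext_square_relations_closed[OF cring A.module]] that
    by (auto simp: ext_square_kernel_def)
  \<comment> \<open>Each bilinearity law becomes an equality of cosets whose representatives differ
    by a single generating relation.\<close>
  note eqI = quot_module_coset_eqI[OF sub1 _ _ rel]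
  show ?thesis
  proof (unfold_locales)
    fix x y assume "x \<in> carrier A" "y \<in> carrier A"
    then show "HC1_class K A x y \<in> carrier (HC1 K A)" by (simp add: HC1_class_def wc)
  next
    fix x y z assume xyz: "x \<in> carrier A" "y \<in> carrier A" "z \<in> carrier A"
    have "free_gen K (x \<oplus>\<^bsub>A\<^esub> y, z) \<ominus>\<^bsub>?F\<^esub> (free_gen K (x, z) \<oplus>\<^bsub>?F\<^esub> free_gen K (y, z)) \<in> ext_square_relations K A"
      unfolding ext_square_relations_def Let_def using xyz by blast
    from eqI[OF _ _ this] have "wedge K A (x \<oplus>\<^bsub>A\<^esub> y) z = wedge K A x z \<oplus>\<^bsub>?E\<^esub> wedge K A y z"
      unfolding wedge_def using xyz by (simp add: fg)
    then show "HC1_class K A (x \<oplus>\<^bsub>A\<^esub> y) z = HC1_class K A x z \<oplus>\<^bsub>HC1 K A\<^esub> HC1_class K A y z"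
      using xyz by (simp add: HC1_class_def wc)
    have "free_gen K (z, x \<oplus>\<^bsub>A\<^esub> y) \<ominus>\<^bsub>?F\<^esub> (free_gen K (z, x) \<oplus>\<^bsub>?F\<^esub> free_gen K (z, y)) \<in> ext_square_relations K A"
      unfolding ext_square_relations_def Let_def using xyz by blast
    from eqI[OF _ _ this] have "wedge K A z (x \<oplus>\<^bsub>A\<^esub> y) = wedge K A z x \<oplus>\<^bsub>?E\<^esub> wedge K A z y"
      unfolding wedge_def using xyz by (simp add: fg)
    then show "HC1_class K A z (x \<oplus>\<^bsub>A\<^esub> y) = HC1_class K A z x \<oplus>\<^bsub>HC1 K A\<^esub> HC1_class K A z y"
      using xyz by (simp add: HC1_class_def wc)
  next
    fix c x y assume xyz: "c \<in> carrier K" "x \<in> carrier A" "y \<in> carrier A"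
    have "free_gen K (c \<odot>\<^bsub>A\<^esub> x, y) \<ominus>\<^bsub>?F\<^esub> c \<odot>\<^bsub>?F\<^esub> free_gen K (x, y) \<in> ext_square_relations K A"
      unfolding ext_square_relations_def Let_def using xyz by blast
    from eqI[OF _ _ this] have "wedge K A (c \<odot>\<^bsub>A\<^esub> x) y = c \<odot>\<^bsub>?E\<^esub> wedge K A x y"
      unfolding wedge_def using xyz by (simp add: fg)
    then show "HC1_class K A (c \<odot>\<^bsub>A\<^esub> x) y = c \<odot>\<^bsub>HC1 K A\<^esub> HC1_class K A x y"
      using xyz by (simp add: HC1_class_def wc)
    have "free_gen K (x, c \<odot>\<^bsub>A\<^esub> y) \<ominus>\<^bsub>?F\<^esub> c \<odot>\<^bsub>?F\<^esub> free_gen K (x, y) \<in> ext_square_relations K A"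
      unfolding ext_square_relations_def Let_def using xyz by blast
    from eqI[OF _ _ this] have "wedge K A x (c \<odot>\<^bsub>A\<^esub> y) = c \<odot>\<^bsub>?E\<^esub> wedge K A x y"
      unfolding wedge_def using xyz by (simp add: fg)
    then show "HC1_class K A x (c \<odot>\<^bsub>A\<^esub> y) = c \<odot>\<^bsub>HC1 K A\<^esub> HC1_class K A x y"
      using xyz by (simp add: HC1_class_def wc)
  next
    fix x assume x: "x \<in> carrier A"
    have "free_gen K (x, x) \<in> ext_square_relations K A"
      unfolding ext_square_relations_def Let_def using x by blast
    then have "wedge K A x x = \<zero>\<^bsub>?E\<^esub>"
      unfolding wedge_def ext_square_def by (intro quot_module_coset_eq_zero[OF sub1] rel)
    then show "HC1_class K A x x = \<zero>\<^bsub>HC1 K A\<^esub>" by (simp add: HC1_class_def)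
  next
    fix x y z assume xyz: "x \<in> carrier A" "y \<in> carrier A" "z \<in> carrier A"
    let ?S = "{wedge K A (a \<otimes>\<^bsub>A\<^esub> b) c \<oplus>\<^bsub>?E\<^esub> wedge K A (b \<otimes>\<^bsub>A\<^esub> c) a
        \<oplus>\<^bsub>?E\<^esub> wedge K A (c \<otimes>\<^bsub>A\<^esub> a) b | a b c.
        a \<in> carrier A \<and> b \<in> carrier A \<and> c \<in> carrier A}"
    let ?r = "wedge K A (x \<otimes>\<^bsub>A\<^esub> y) z \<oplus>\<^bsub>?E\<^esub> wedge K A (y \<otimes>\<^bsub>A\<^esub> z) x
        \<oplus>\<^bsub>?E\<^esub> wedge K A (z \<otimes>\<^bsub>A\<^esub> x) y"
    have "?S \<subseteq> carrier ?E" by (auto simp: wc)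
    then have "?S \<subseteq> cyclic_relations K A"
      unfolding cyclic_relations_def by (rule p.N.in_own_span)
    moreover have "?r \<in> ?S" using xyz by blast
    ultimately have "?r \<in> cyclic_relations K A" by (rule subsetD)
    then have "cyclic_relations K A +>\<^bsub>?E\<^esub> ?r = \<zero>\<^bsub>HC1 K A\<^esub>"
      unfolding HC1_def by (rule quot_module_coset_eq_zero[OF sub2])
    then show "HC1_class K A (x \<otimes>\<^bsub>A\<^esub> y) z \<oplus>\<^bsub>HC1 K A\<^esub> HC1_class K A (y \<otimes>\<^bsub>A\<^esub> z) x
        \<oplus>\<^bsub>HC1 K A\<^esub> HC1_class K A (z \<otimes>\<^bsub>A\<^esub> x) y = \<zero>\<^bsub>HC1 K A\<^esub>"
      using xyz by (simp add: HC1_class_def wc)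
  qed
qed

text \<open>Pull \<open>X\<close> back along the composite of the two projections. The preimage is a
  submodule of the free module containing all generators, hence everything, and the composite is
  onto.\<close>

lemma HC1_generated:
  assumes "algebra K A" and sub: "submodule K X (HC1 K A)"
    and gen: "\<And>x y. x \<in> carrier A \<Longrightarrow> y \<in> carrier A \<Longrightarrow> HC1_class K A x y \<in> X"
  shows "X = carrier (HC1 K A)"
proof -
  let ?F = "free_module K (carrier A \<times> carrier A)"
  let ?E = "ext_square K A"
  interpret A: algebra K A by fact
  interpret X: LinearCombinations.submodule K X "HC1 K A" by fact
  have sub1: "submodule K (ext_square_kernel K A) ?F"
    by (rule ext_square_kernel_submodule) (rule A.module)
  have sub2: "submodule K (cyclic_relations K A) ?E"
    by (rule cyclic_relations_submodule) fact
  interpret p: mod_hom K ?F ?E "\<lambda>x. ext_square_kernel K A +>\<^bsub>?F\<^esub> x"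
    using quot_module_proj[OF sub1] by (simp add: ext_square_def)
  interpret q: mod_hom K ?E "HC1 K A" "\<lambda>x. cyclic_relations K A +>\<^bsub>?E\<^esub> x"
    using quot_module_proj[OF sub2] by (simp add: HC1_def)
  let ?h = "\<lambda>x. cyclic_relations K A +>\<^bsub>?E\<^esub> (ext_square_kernel K A +>\<^bsub>?F\<^esub> x)"
  let ?Y = "{x \<in> carrier ?F. ?h x \<in> X}"
  have "submodule K ?Y ?F"
    by (rule submodule.intro[OF p.M.module_axioms]) auto
  moreover have "free_gen K s \<in> ?Y" if "s \<in> carrier A \<times> carrier A" for s
    using gen[of "fst s" "snd s"] that free_gen_closed[OF A.R_cring that]
    by (auto simp: HC1_class_def wedge_def)
  ultimately have Y: "?Y = carrier ?F" by (intro free_module_generated A.R_cring)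
  have "?h x \<in> X" if "x \<in> carrier ?F" for x
    using subsetD[OF equalityD2[OF Y] that] by simp
  moreover have "carrier (HC1 K A) = ?h ` carrier ?F"
    by (simp add: HC1_def ext_square_def quot_module_carrier image_image)
  ultimately have "carrier (HC1 K A) \<subseteq> X" by (simp add: image_subsetI)
  with X.subset show ?thesis by (rule subset_antisym)
qed

section \<open>Brackets on the nodal algebra\<close>

lemma genideal_poly_algebra: "Idl\<^bsub>poly_algebra\<^esub> {f} = range (\<lambda>q. f * q)"
proof -
  interpret algebra complex_field poly_algebra by (rule poly_algebra_is_algebra)
  have "PIdl\<^bsub>poly_algebra\<^esub> f = Idl\<^bsub>poly_algebra\<^esub> {f}"
    by (rule cgenideal_eq_genideal) (simp add: poly_algebra_def)
  then show ?thesis by (auto simp: cgenideal_def poly_algebra_def mult.commute)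
qed

lemma scalars_plus_ideal_ops:
  "mult (scalars_plus_ideal I) = (*)" "one (scalars_plus_ideal I) = 1"
  "ring.zero (scalars_plus_ideal I) = 0" "ring.add (scalars_plus_ideal I) = (+)"
  "module.smult (scalars_plus_ideal I) = Polynomial.smult"
  by (simp_all add: scalars_plus_ideal_def poly_algebra_def)

lemma carrier_scalars_plus_genideal:
  "carrier (scalars_plus_ideal (Idl\<^bsub>poly_algebra\<^esub> {f})) = {[:c:] + f * q | c q. True}"
  unfolding genideal_poly_algebra
  by (auto simp: scalars_plus_ideal_def set_add_def' poly_algebra_def)

lemma algebra_scalars_plus_genideal:
  "algebra complex_field (scalars_plus_ideal (Idl\<^bsub>poly_algebra\<^esub> {f}))"
proof -
  interpret P: algebra complex_field poly_algebra by (rule poly_algebra_is_algebra)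
  have "ideal (Idl\<^bsub>poly_algebra\<^esub> {f}) poly_algebra"
    by (rule P.genideal_ideal) (simp add: poly_algebra_def)
  then show ?thesis by (rule scalars_plus_ideal_is_algebra)
qed

text \<open>The elements in the conclusion are those of the algebra. Replacing x^2 by u + e leaves
  at most one factor x, and the factor u in front keeps that x inside the algebra.\<close>

lemma nodal_algebra_span:
  fixes u x :: "complex poly"
  assumes x: "x = [:- s, 1:]" and xx: "x * x = u + [:e:]"
    and add: "\<And>p q. p \<in> X \<Longrightarrow> q \<in> X \<Longrightarrow> p + q \<in> X"
    and smult: "\<And>c p. p \<in> X \<Longrightarrow> Polynomial.smult c p \<in> X"
    and pow: "\<And>k. u ^ k \<in> X" and pow': "\<And>k. u ^ k * (x * u) \<in> X"
  shows "[:c:] + u * q \<in> X"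
proof -
  \<comment> \<open>The two families go together: one more factor x turns the first into the second,
    and the second back into the first with exponents k + 2 and k + 1.\<close>
  have "\<forall>k. u ^ Suc k * q \<in> X \<and> u ^ Suc k * (x * q) \<in> X"
  proof (induction q rule: pCons_induct)
    case 0
    show ?case using smult[OF pow, of 0] by simp
  next
    case (pCons a q)
    \<comment> \<open>Here \<open>pCons a q\<close> is a + tq, and t = x + s.\<close>
    have q: "pCons a q = [:a:] + x * q + Polynomial.smult s q" by (simp add: x)
    show ?case
    proof
      fix k
      have "u ^ Suc k * pCons a q =
          Polynomial.smult a (u ^ Suc k) + u ^ Suc k * (x * q) + Polynomial.smult s (u ^ Suc k * q)"
        by (simp add: q algebra_simps)
      moreover have "u ^ Suc k * (x * pCons a q) = Polynomial.smult a (u ^ k * (x * u))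
          + u ^ Suc k * ((x * x) * q) + Polynomial.smult s (u ^ Suc k * (x * q))"
        by (simp add: q algebra_simps)
      moreover have "u ^ Suc k * ((x * x) * q) =
          u ^ Suc (Suc k) * q + Polynomial.smult e (u ^ Suc k * q)"
        unfolding xx by (simp add: algebra_simps)
      ultimately show "u ^ Suc k * pCons a q \<in> X \<and> u ^ Suc k * (x * pCons a q) \<in> X"
        using pCons.IH by (simp only:) (intro conjI add smult pow pow'; blast)
    qed
  qed
  then have "u * q \<in> X" by (metis power_one_right One_nat_def)
  moreover have "[:c:] = Polynomial.smult c (u ^ 0)" by simp
  ultimately show ?thesis using add smult pow by metis
qed

text \<open>Coordinates after completing the square: \<open>u\<close> is the quadratic generating
  the ideal, \<open>s\<close> the midpoint of its roots, and u = x^2 - e.\<close>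

locale nodal_bracket = cyclic_bracket complex_field A M b
  for A :: "(complex, complex poly) module" and M :: "(complex, 'm, 'z) module_scheme" and b +
  fixes u x :: "complex poly" and s e :: complex
  assumes A_eq: "A = scalars_plus_ideal (Idl\<^bsub>poly_algebra\<^esub> {u})"
    and x_eq: "x = [:- s, 1:]" and xx: "x * x = u + [:e:]"
begin

definition v where "v = x * u"

lemma A_ops [simp]:
  "mult A = (*)" "one A = 1" "ring.zero A = 0" "ring.add A = (+)" "module.smult A = Polynomial.smult"
  by (simp_all add: A_eq scalars_plus_ideal_ops)

lemma carrier_A: "carrier A = {[:c:] + u * q | c q. True}"
  by (simp add: A_eq carrier_scalars_plus_genideal)

lemma A_times: "p \<in> carrier A \<Longrightarrow> q \<in> carrier A \<Longrightarrow> p * q \<in> carrier A"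
  using A.m_closed[of p q] by simp

lemma A_plus: "p \<in> carrier A \<Longrightarrow> q \<in> carrier A \<Longrightarrow> p + q \<in> carrier A"
  using A.M.a_closed[of p q] by simp

lemma A_smult: "p \<in> carrier A \<Longrightarrow> Polynomial.smult c p \<in> carrier A"
  using A.smult_closed[of c p] by simp

lemma A_u_mult: "u * q \<in> carrier A"
  unfolding carrier_A by (rule CollectI, rule exI[of _ 0], rule exI[of _ q]) simp

lemma A_u: "u \<in> carrier A"
  using A_u_mult[of 1] by simp

lemma A_v: "v \<in> carrier A"
  using A_u_mult[of x] by (simp add: v_def mult.commute)

lemma A_power: "p \<in> carrier A \<Longrightarrow> p ^ k \<in> carrier A"
  using A.one_closed by (induction k) (auto intro: A_times)

lemmas A_intros [simp, intro] = A_times A_plus A_smult A_u A_v A_power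

lemma b_add_left': "\<lbrakk>p \<in> carrier A; q \<in> carrier A; r \<in> carrier A\<rbrakk> \<Longrightarrow> b (p + q) r = b p r \<oplus>\<^bsub>M\<^esub> b q r"
  using b_add_left[of p q r] by simp

lemma b_add_right': "\<lbrakk>p \<in> carrier A; q \<in> carrier A; r \<in> carrier A\<rbrakk> \<Longrightarrow> b r (p + q) = b r p \<oplus>\<^bsub>M\<^esub> b r q"
  using b_add_right[of p q r] by simp

lemma b_smult_left': "\<lbrakk>p \<in> carrier A; q \<in> carrier A\<rbrakk> \<Longrightarrow> b (Polynomial.smult c p) q = c \<odot>\<^bsub>M\<^esub> b p q"
  using b_smult_left[of c p q] by simp

lemma b_smult_right': "\<lbrakk>p \<in> carrier A; q \<in> carrier A\<rbrakk> \<Longrightarrow> b p (Polynomial.smult c q) = c \<odot>\<^bsub>M\<^esub> b p q"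
  using b_smult_right[of c p q] by simp

lemma b_mult_left': "\<lbrakk>p \<in> carrier A; q \<in> carrier A; r \<in> carrier A\<rbrakk> \<Longrightarrow>
    b (p * q) r = b p (q * r) \<oplus>\<^bsub>M\<^esub> b q (r * p)"
  using b_mult_left[of p q r] by simp

lemma smult_add': "m \<in> carrier M \<Longrightarrow> (c + d) \<odot>\<^bsub>M\<^esub> m = c \<odot>\<^bsub>M\<^esub> m \<oplus>\<^bsub>M\<^esub> d \<odot>\<^bsub>M\<^esub> m"
  using M.smult_l_distr[of c d m] by simp

lemma smult_smult': "m \<in> carrier M \<Longrightarrow> c \<odot>\<^bsub>M\<^esub> (d \<odot>\<^bsub>M\<^esub> m) = (c * d) \<odot>\<^bsub>M\<^esub> m"
  using M.smult_assoc1[of c d m] by simp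

lemma smult_closed': "m \<in> carrier M \<Longrightarrow> c \<odot>\<^bsub>M\<^esub> m \<in> carrier M"
  using M.smult_closed[of c m] by simp

lemma smult_1': "m \<in> carrier M \<Longrightarrow> 1 \<odot>\<^bsub>M\<^esub> m = m"
  using M.smult_one[of m] by simp

lemma b_swap': "\<lbrakk>p \<in> carrier A; q \<in> carrier A\<rbrakk> \<Longrightarrow> b q p = (- 1) \<odot>\<^bsub>M\<^esub> b p q"
  using M.smult_minus_1[of "b p q"] b_swap[of p q] by (simp add: class_ring_simps)

text \<open>Modulo exact forms both sides are -(m+1) p^m g dp. The induction peels off one factor
  \<open>p\<close> at a time by the product rule.\<close>

lemma b_power:
  assumes "p \<in> carrier A" and "g \<in> carrier A"
  shows "b (p ^ Suc m) g = of_nat (Suc m) \<odot>\<^bsub>M\<^esub> b p (p ^ m * g)"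
  using assms(2)
proof (induction m arbitrary: g)
  case 0
  then show ?case using assms by (simp add: smult_1')
next
  case (Suc m)
  have "b (p ^ Suc (Suc m)) g = b p (p ^ Suc m * g) \<oplus>\<^bsub>M\<^esub> b (p ^ Suc m) (g * p)"
    using b_mult_left'[of p "p ^ Suc m" g] assms Suc.prems by simp
  also have "b (p ^ Suc m) (g * p) = of_nat (Suc m) \<odot>\<^bsub>M\<^esub> b p (p ^ m * (g * p))"
    using Suc.prems assms by (intro Suc.IH) auto
  also have "p ^ m * (g * p) = p ^ Suc m * g" by simp
  also have "b p (p ^ Suc m * g) \<oplus>\<^bsub>M\<^esub> of_nat (Suc m) \<odot>\<^bsub>M\<^esub> b p (p ^ Suc m * g)
      = (1 + of_nat (Suc m)) \<odot>\<^bsub>M\<^esub> b p (p ^ Suc m * g)"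
    using assms Suc.prems by (subst smult_add') (auto simp: smult_1')
  also have "1 + of_nat (Suc m) = (of_nat (Suc (Suc m)) :: complex)" by simp
  finally show ?case .
qed

end

section \<open>Reduction of all brackets to w_0 and w_1 modulo a submodule\<close>

locale nodal_bracket_submodule = nodal_bracket + S: LinearCombinations.submodule complex_field S M for S
begin

lemma S_smult: "m \<in> S \<Longrightarrow> c \<odot>\<^bsub>M\<^esub> m \<in> S"
  using S.smult_closed[of c m] by simp

lemma S_smult_cancel:
  assumes "m \<in> carrier M" and "c \<odot>\<^bsub>M\<^esub> m \<in> S" and "c \<noteq> 0"
  shows "m \<in> S"
  using S_smult[OF assms(2), of "inverse c"] assms by (simp add: smult_smult' smult_1')

lemma S_swap: "\<lbrakk>p \<in> carrier A; q \<in> carrier A; b p q \<in> S\<rbrakk> \<Longrightarrow> b q p \<in> S"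
  by (simp add: b_swap'[of p q] S_smult)

text \<open>Two evaluations of one bracket that give \<open>m\<close> different coefficients, modulo
  \<open>S\<close>, force \<open>m\<close> into \<open>S\<close>: subtract and divide by c -
  d.\<close>

lemma S_smult_eq:
  assumes m: "m \<in> carrier M" and n: "n \<in> S" "n' \<in> S" and "c \<noteq> d"
    and eq: "c \<odot>\<^bsub>M\<^esub> m \<oplus>\<^bsub>M\<^esub> n = d \<odot>\<^bsub>M\<^esub> m \<oplus>\<^bsub>M\<^esub> n'"
  shows "m \<in> S"
proof -
  have nM: "n \<in> carrier M" "n' \<in> carrier M" using n S.subset by auto
  have minus: "m' \<oplus>\<^bsub>M\<^esub> (- 1) \<odot>\<^bsub>M\<^esub> m' = \<zero>\<^bsub>M\<^esub>" if "m' \<in> carrier M" for m'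
    using smult_add'[OF that, of 1 "- 1"] that M.smult_l_null[OF that] by (simp add: smult_1')
  have "(c - d) \<odot>\<^bsub>M\<^esub> m = (c \<odot>\<^bsub>M\<^esub> m \<oplus>\<^bsub>M\<^esub> n) \<oplus>\<^bsub>M\<^esub> ((- 1) \<odot>\<^bsub>M\<^esub> n \<oplus>\<^bsub>M\<^esub> (- d) \<odot>\<^bsub>M\<^esub> m)"
    using m nM minus[OF nM(1)] smult_add'[OF m, of c "- d"]
    by (simp add: M.M.a_assoc smult_closed' M.M.a_assoc[symmetric, of n "(- 1) \<odot>\<^bsub>M\<^esub> n"])
  also have "\<dots> = (d \<odot>\<^bsub>M\<^esub> m \<oplus>\<^bsub>M\<^esub> n') \<oplus>\<^bsub>M\<^esub> ((- 1) \<odot>\<^bsub>M\<^esub> n \<oplus>\<^bsub>M\<^esub> (- d) \<odot>\<^bsub>M\<^esub> m)"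
    by (simp only: eq)
  also have "\<dots> = (d \<odot>\<^bsub>M\<^esub> m \<oplus>\<^bsub>M\<^esub> (- 1) \<odot>\<^bsub>M\<^esub> (d \<odot>\<^bsub>M\<^esub> m)) \<oplus>\<^bsub>M\<^esub> (n' \<oplus>\<^bsub>M\<^esub> (- 1) \<odot>\<^bsub>M\<^esub> n)"
    using m nM by (simp add: smult_closed' smult_smult' M.M.a_ac)
  also have "\<dots> = n' \<oplus>\<^bsub>M\<^esub> (- 1) \<odot>\<^bsub>M\<^esub> n"
    using m nM by (simp add: minus smult_closed')
  finally have "(c - d) \<odot>\<^bsub>M\<^esub> m \<in> S" using n by (simp add: S_smult)
  then show ?thesis using \<open>c \<noteq> d\<close> by (intro S_smult_cancel[OF m, of "c - d"]) simp_all
qed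

text \<open>The admissible right arguments are closed under linear combinations, so the spanning
  family of \<open>nodal_algebra_span\<close> is enough to test.\<close>

lemma S_right:
  assumes "p \<in> carrier A" and "q \<in> carrier A"
    and pow: "\<And>k. b p (u ^ k) \<in> S" and pow': "\<And>k. b p (u ^ k * v) \<in> S"
  shows "b p q \<in> S"
proof -
  let ?X = "{q \<in> carrier A. b p q \<in> S}"
  obtain c r where q: "q = [:c:] + u * r" using assms(2) by (auto simp: carrier_A)
  have "q \<in> ?X" unfolding q
    by (rule nodal_algebra_span[OF x_eq xx])
      (use assms(1) pow pow' in \<open>auto simp flip: v_def simp: b_add_right' b_smult_right' S_smult\<close>)
  then show ?thesis by simp
qed

lemma S_left_mult:
  assumes "p \<in> carrier A" and "q \<in> carrier A" and "r \<in> carrier A"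
    and "\<And>r. r \<in> carrier A \<Longrightarrow> b p r \<in> S" and "\<And>r. r \<in> carrier A \<Longrightarrow> b q r \<in> S"
  shows "b (p * q) r \<in> S"
  using assms by (auto simp: b_mult_left')

lemma S_left_power:
  assumes "p \<in> carrier A" and "r \<in> carrier A"
    and "\<And>r. r \<in> carrier A \<Longrightarrow> b p r \<in> S"
  shows "b (p ^ k) r \<in> S"
  using assms(2)
proof (induction k arbitrary: r)
  case 0
  then show ?case by (simp add: b_one_left[simplified])
next
  case (Suc k)
  then show ?case using assms(1,3) by (auto intro!: S_left_mult)
qed

text \<open>The form u d(u^k) is exact. For k = m + 1, the power rule and antisymmetry evaluate the
  same bracket with coefficients m + 1 and -1.\<close>

lemma b_u_u: "b u (u ^ k) \<in> S"
proof (cases k)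
  case 0
  then show ?thesis using S_swap[of 1 u] b_one_left[of u] A.one_closed by simp
next
  case (Suc m)
  have "b (u ^ Suc m) u = of_nat (Suc m) \<odot>\<^bsub>M\<^esub> b u (u ^ Suc m)"
    using b_power[of u u m] by (simp add: mult.commute)
  moreover have "b (u ^ Suc m) u = (- 1) \<odot>\<^bsub>M\<^esub> b u (u ^ Suc m)"
    by (rule b_swap') auto
  \<comment> \<open>The added zeros fit the pattern of \<open>S_smult_eq\<close>.\<close>
  ultimately have eq: "of_nat (Suc m) \<odot>\<^bsub>M\<^esub> b u (u ^ Suc m) \<oplus>\<^bsub>M\<^esub> \<zero>\<^bsub>M\<^esub>
      = (- 1) \<odot>\<^bsub>M\<^esub> b u (u ^ Suc m) \<oplus>\<^bsub>M\<^esub> \<zero>\<^bsub>M\<^esub>" by simp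
  have "of_nat (Suc m) + 1 \<noteq> (0::complex)"
    using of_nat_neq_0[of "Suc m", where 'a=complex] by (simp add: add.commute)
  then have "of_nat (Suc m) \<noteq> (- 1 :: complex)" by (metis add.commute add.right_inverse)
  from S_smult_eq[OF _ S.zero_closed S.zero_closed this eq] show ?thesis
    unfolding Suc by auto
qed

lemma vv: "v * v = u ^ 3 + Polynomial.smult e (u ^ 2)"
proof -
  have "v * v = (x * x) * u\<^sup>2" by (simp add: v_def power2_eq_square)
  then show ?thesis unfolding xx by (simp add: algebra_simps power2_eq_square power3_eq_cube)
qed

lemma b_v_power: "b v (u ^ Suc m) = (- of_nat (Suc m)) \<odot>\<^bsub>M\<^esub> b u (u ^ m * v)"
  using b_swap'[of "u ^ Suc m" v] b_power[of u v m]
  by (simp add: smult_smult' del: power_Suc of_nat_Suc)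

text \<open>The recursion for w_k, from the two evaluations of the bracket of v^2 with u^k v. It
  starts at w_1 and never involves w_0, so w_0 and w_1 must both be supplied.\<close>

lemma b_u_v_step:
  assumes "b u (u ^ Suc k * v) \<in> S"
  shows "b u (u ^ Suc (Suc k) * v) \<in> S"
proof -
  let ?w = "\<lambda>k. b u (u ^ k * v)"
  let ?P = "- of_nat (Suc (Suc (Suc k))) :: complex"
  let ?Q = "e * (- of_nat (Suc (Suc k)))"
  have w: "?w k \<in> carrier M" for k by auto
  \<comment> \<open>First evaluation: the product rule gives twice the bracket of v with u^k v^2 =
    u^(k+3) + e u^(k+2). By \<open>b_v_power\<close> its two terms carry the coefficients
    \<open>?P\<close> = -(k+3) and \<open>?Q\<close> = -e(k+2).\<close>
  have "b (v * v) (u ^ k * v) = b v (v * (u ^ k * v)) \<oplus>\<^bsub>M\<^esub> b v ((u ^ k * v) * v)"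
    by (rule b_mult_left') auto
  also have "(u ^ k * v) * v = u ^ k * (v * v)" by (simp only: mult_ac)
  also have "v * (u ^ k * v) = u ^ k * (v * v)" by (simp only: mult_ac)
  also have "u ^ k * (v * v) = u ^ Suc (Suc (Suc k)) + Polynomial.smult e (u ^ Suc (Suc k))"
    unfolding vv by (simp add: algebra_simps eval_nat_numeral)
  also have "b v (u ^ Suc (Suc (Suc k)) + Polynomial.smult e (u ^ Suc (Suc k)))
      = ?P \<odot>\<^bsub>M\<^esub> ?w (Suc (Suc k)) \<oplus>\<^bsub>M\<^esub> ?Q \<odot>\<^bsub>M\<^esub> ?w (Suc k)"
    by (simp only: b_add_right' b_smult_right' A_intros b_v_power smult_smult'[OF w])
  also have "(?P \<odot>\<^bsub>M\<^esub> ?w (Suc (Suc k)) \<oplus>\<^bsub>M\<^esub> ?Q \<odot>\<^bsub>M\<^esub> ?w (Suc k))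
        \<oplus>\<^bsub>M\<^esub> (?P \<odot>\<^bsub>M\<^esub> ?w (Suc (Suc k)) \<oplus>\<^bsub>M\<^esub> ?Q \<odot>\<^bsub>M\<^esub> ?w (Suc k))
      = (?P + ?P) \<odot>\<^bsub>M\<^esub> ?w (Suc (Suc k)) \<oplus>\<^bsub>M\<^esub> (?Q + ?Q) \<odot>\<^bsub>M\<^esub> ?w (Suc k)"
    by (simp only: smult_add'[OF w] M.M.a_ac smult_closed' w M.M.a_closed)
  finally have 1: "b (v * v) (u ^ k * v) =
      (?P + ?P) \<odot>\<^bsub>M\<^esub> ?w (Suc (Suc k)) \<oplus>\<^bsub>M\<^esub> (?Q + ?Q) \<odot>\<^bsub>M\<^esub> ?w (Suc k)" .
  \<comment> \<open>Second evaluation: replace v^2 by u^3 + e u^2 first and use the power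
    rule.\<close>
  have "b (v * v) (u ^ k * v) = b (u ^ Suc 2) (u ^ k * v) \<oplus>\<^bsub>M\<^esub> e \<odot>\<^bsub>M\<^esub> b (u ^ Suc 1) (u ^ k * v)"
    unfolding vv by (subst b_add_left') (auto simp: b_smult_left' eval_nat_numeral)
  also have "\<dots> = 3 \<odot>\<^bsub>M\<^esub> b u (u ^ 2 * (u ^ k * v)) \<oplus>\<^bsub>M\<^esub> e \<odot>\<^bsub>M\<^esub> (2 \<odot>\<^bsub>M\<^esub> b u (u ^ 1 * (u ^ k * v)))"
    by (subst (1 2) b_power) auto
  also have "u ^ 2 * (u ^ k * v) = u ^ Suc (Suc k) * v" by (simp add: power2_eq_square mult_ac)
  also have "u ^ 1 * (u ^ k * v) = u ^ Suc k * v" by (simp add: mult_ac)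
  finally have 2: "b (v * v) (u ^ k * v) = 3 \<odot>\<^bsub>M\<^esub> ?w (Suc (Suc k)) \<oplus>\<^bsub>M\<^esub> (e * 2) \<odot>\<^bsub>M\<^esub> ?w (Suc k)"
    using w by (simp add: smult_smult' del: power_Suc)
  \<comment> \<open>The coefficients of w_(k+2) differ by 2k + 9, a positive integer.\<close>
  have "(3::complex) \<noteq> ?P + ?P"
  proof
    assume "(3::complex) = ?P + ?P"
    moreover have "(of_nat (2 * k + 9) :: complex) = 3 - (?P + ?P)" by simp
    ultimately have "(of_nat (2 * k + 9) :: complex) = 0" by simp
    then show False by (simp only: of_nat_eq_0_iff)
  qed
  from S_smult_eq[OF w S_smult[OF assms] S_smult[OF assms] this trans[OF 2[symmetric] 1]]
  show ?thesis .
qed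

text \<open>Brackets are settled in stages: u against everything, powers of u against everything, v
  against everything, and finally arbitrary pairs.\<close>

lemma b_mem:
  assumes "b u v \<in> S" and "b u (u * v) \<in> S" and "p \<in> carrier A" and "q \<in> carrier A"
  shows "b p q \<in> S"
proof -
  have w: "b u (u ^ k * v) \<in> S" for k
  proof (cases k)
    case 0
    then show ?thesis using assms(1) by simp
  next
    case (Suc m)
    have "b u (u ^ Suc m * v) \<in> S"
    proof (induction m)
      case 0
      then show ?case using assms(2) by simp
    qed (rule b_u_v_step)
    then show ?thesis unfolding Suc .
  qed
  have u: "b u r \<in> S" if "r \<in> carrier A" for r
    by (rule S_right[OF A_u that b_u_u w])
  have pow: "b (u ^ k) r \<in> S" if "r \<in> carrier A" for r k
    using S_left_power[OF A_u that u] .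
  have v_pow: "b v (u ^ k) \<in> S" for k
    by (rule S_swap) (auto intro: pow)
  \<comment> \<open>The bracket of v^2 with u^k lies in \<open>S\<close> because v^2 is a polynomial
    in u; by the product rule it is also twice the wanted bracket.\<close>
  have v_pow': "b v (u ^ k * v) \<in> S" for k
  proof -
    have "b (v * v) (u ^ k) \<in> S"
      unfolding vv by (subst b_add_left') (auto simp: b_smult_left' S_smult pow)
    moreover have "b (v * v) (u ^ k) = 2 \<odot>\<^bsub>M\<^esub> b v (u ^ k * v)"
      using b_mult_left'[of v v "u ^ k"] smult_add'[of "b v (u ^ k * v)" 1 1]
      by (simp add: smult_1' mult.commute[of v "u ^ k"] one_add_one)
    ultimately have "2 \<odot>\<^bsub>M\<^esub> b v (u ^ k * v) \<in> S" by simp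
    then show ?thesis by (rule S_smult_cancel[rotated]) auto
  qed
  have v: "b v r \<in> S" if "r \<in> carrier A" for r
    by (rule S_right[OF A_v that v_pow v_pow'])
  show ?thesis
  \<comment> \<open>Keep \<open>q\<close> fixed on the left and let \<open>p\<close> run through the
    spanning family. A second swap puts u^k v on the left, where the product rule splits it.\<close>
  proof (rule S_swap[OF assms(4,3)], rule S_right[OF assms(4,3)])
    fix k
    show "b q (u ^ k) \<in> S" by (rule S_swap) (use assms pow in auto)
    show "b q (u ^ k * v) \<in> S"
      by (rule S_swap) (use assms pow v in \<open>auto intro!: S_left_mult\<close>)
  qed
qed

end

section \<open>The two functionals and the dimension\<close>

definition scalar_module :: "(complex, complex) module" where
  "scalar_module = \<lparr>carrier = UNIV, mult = (*), one = 1, zero = 0, add = (+), smult = (*)\<rparr>"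

lemma scalar_module_simps [simp]:
  "carrier scalar_module = UNIV" "ring.zero scalar_module = 0" "ring.add scalar_module = (+)"
  "module.smult scalar_module = (*)"
  by (simp_all add: scalar_module_def)

lemma module_scalar_module: "module complex_field scalar_module"
proof (rule moduleI)
  show "cring complex_field" by (rule class_cring.is_cring)
  show "abelian_group scalar_module"
  proof (rule abelian_groupI)
    fix z :: complex
    show "\<exists>y\<in>carrier scalar_module. y \<oplus>\<^bsub>scalar_module\<^esub> z = \<zero>\<^bsub>scalar_module\<^esub>"
      by (rule bexI[of _ "- z"]) simp_all
  qed (simp_all add: algebra_simps)
qed (simp_all add: algebra_simps)

section \<open>Definite integrals of polynomials through antiderivatives\<close>

lemma pderiv_surj: "\<exists>q. pderiv q = p" for p :: "'a :: field_char_0 poly"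
proof -
  have sum: "pderiv (sum g S) = (\<Sum>i\<in>S. pderiv (g i))" for g :: "nat \<Rightarrow> 'a poly" and S
    by (induction S rule: infinite_finite_induct) (simp_all add: pderiv_add)
  have "pderiv (\<Sum>i\<le>degree p. monom (coeff p i / of_nat (Suc i)) (Suc i))
      = (\<Sum>i\<le>degree p. monom (coeff p i) i)"
    by (simp add: sum pderiv_monom del: of_nat_Suc)
  then show ?thesis by (auto simp: poly_as_sum_of_monoms)
qed

text \<open>The integral from \<open>a\<close> to \<open>b\<close> in algebraic form. An
  antiderivative exists by \<open>pderiv_surj\<close>, and its arbitrary constant cancels between
  the endpoints.\<close>

definition poly_integral :: "'a \<Rightarrow> 'a \<Rightarrow> 'a :: field_char_0 poly \<Rightarrow> 'a" where
  "poly_integral a b p = (let q = SOME q. pderiv q = p in poly q b - poly q a)"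

lemma poly_integral_pderiv: "poly_integral a b (pderiv q) = poly q b - poly q a"
proof -
  define r where "r = (SOME r. pderiv r = pderiv q)"
  have "pderiv r = pderiv q" unfolding r_def by (rule someI) simp
  then have "pderiv (r - q) = 0" by (simp add: pderiv_diff)
  then obtain h where "r - q = [:h:]" using pderiv_iszero by blast
  then have "r = q + [:h:]" by (simp add: algebra_simps)
  then show ?thesis by (simp add: poly_integral_def Let_def flip: r_def)
qed

lemma poly_integral_add: "poly_integral a b (p + q) = poly_integral a b p + poly_integral a b q"
  using pderiv_surj[of p] pderiv_surj[of q]
  by (auto simp: poly_integral_pderiv simp flip: pderiv_add)

lemma poly_integral_smult: "poly_integral a b (Polynomial.smult c p) = c * poly_integral a b p"
  using pderiv_surj[of p] by (auto simp: poly_integral_pderiv algebra_simps simp flip: pderiv_smult)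

section \<open>The two functionals and their values on w_0 and w_1\<close>

locale nodal_curve =
  fixes a1 a2 :: complex and f :: "complex poly" and A :: "(complex, complex poly) module"
  assumes distinct: "a1 \<noteq> a2"
    and f_eq: "f = [:- a1, 1:] * [:- a2, 1:]"
    and A_eq: "A = scalars_plus_ideal (Idl\<^bsub>poly_algebra\<^esub> {f})"
begin

sublocale algebra complex_field A
  unfolding A_eq by (rule algebra_scalars_plus_genideal)

lemma A_ops [simp]:
  "mult A = (*)" "one A = 1" "ring.zero A = 0" "ring.add A = (+)" "module.smult A = Polynomial.smult"
  by (simp_all add: A_eq scalars_plus_ideal_ops)

lemma poly_f [simp]: "poly f a1 = 0" "poly f a2 = 0"
  by (simp_all add: f_eq)

text \<open>Elements of \<open>A\<close> are functions on the line with the two points glued. Hence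
  the derivative of an element of \<open>A\<close> integrates to zero from \<open>a1\<close> to
  \<open>a2\<close>.\<close>

lemma poly_eq: "p \<in> carrier A \<Longrightarrow> poly p a1 = poly p a2"
  by (auto simp: A_eq carrier_scalars_plus_genideal)

text \<open>The self-bracket integrates the derivative of p^2/2, the cyclic sum that of pqr; both
  vanish by \<open>poly_eq\<close>.\<close>

lemma cyclic_bracket_integral:
  "cyclic_bracket complex_field A scalar_module (\<lambda>p q. poly_integral a1 a2 (p * pderiv q))"
proof (intro cyclic_bracket.intro cyclic_bracket_axioms.intro algebra_axioms module_scalar_module;
    (simp add: pderiv_add pderiv_smult poly_integral_add poly_integral_smult distrib_left distrib_right)?)
  fix p assume p: "p \<in> carrier A"
  \<comment> \<open>The coefficient is left as 1/2 + 1/2 to match the two equal terms of the product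
    rule.\<close>
  have "pderiv (Polynomial.smult (1/2) (p * p)) = Polynomial.smult (1/2 + 1/2) (p * pderiv p)"
    by (simp only: pderiv_smult pderiv_mult smult_add_left smult_add_right)
  then have "p * pderiv p = pderiv (Polynomial.smult (1/2) (p * p))" by simp
  then show "poly_integral a1 a2 (p * pderiv p) = 0"
    using poly_eq[OF p] by (simp only: poly_integral_pderiv) simp
next
  fix p q r assume "p \<in> carrier A" "q \<in> carrier A" "r \<in> carrier A"
  note eq = this[THEN poly_eq]
  have "p * q * pderiv r + q * r * pderiv p + r * p * pderiv q = pderiv (p * q * r)"
    by (simp add: pderiv_mult algebra_simps)
  then have "poly_integral a1 a2 (p * q * pderiv r + q * r * pderiv p + r * p * pderiv q) = 0"
    using eq by (simp only: poly_integral_pderiv) simp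
  then show "poly_integral a1 a2 (p * q * pderiv r) + poly_integral a1 a2 (q * r * pderiv p) +
      poly_integral a1 a2 (r * p * pderiv q) = 0"
    by (simp add: poly_integral_add)
qed

text \<open>A determinant of the derivatives along the two branches, hence alternating. As each
  function has one common value at the node, the product rule expands both columns with the same
  scalars, and the cyclic sum cancels in pairs.\<close>

lemma cyclic_bracket_tangent:
  "cyclic_bracket complex_field A scalar_module
    (\<lambda>p q. poly (pderiv p) a1 * poly (pderiv q) a2 - poly (pderiv p) a2 * poly (pderiv q) a1)"
  by (intro cyclic_bracket.intro cyclic_bracket_axioms.intro algebra_axioms module_scalar_module)
    (simp_all add: pderiv_add pderiv_smult pderiv_mult poly_eq algebra_simps)

definition x where "x = [:- ((a1 + a2) / 2), 1:]"

lemma poly_x: "poly x a1 = - ((a2 - a1) / 2)" "poly x a2 = (a2 - a1) / 2"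
  by (simp_all add: x_def field_simps)

lemma pderiv_x [simp]: "pderiv x = 1"
  by (simp add: x_def pderiv_pCons)

lemma x_square: "x * x = f + [:((a2 - a1) / 2)\<^sup>2:]"
  by (simp add: x_def f_eq field_simps power2_eq_square)

lemma integral_nonzero: "poly_integral a1 a2 (f * pderiv (f * (x * f))) \<noteq> 0"
proof -
  define d where "d = (a2 - a1) / 2"
  \<comment> \<open>With \<open>f = x\<^sup>2 - d\<^sup>2\<close>, this is an antiderivative of
    \<open>f (x f\<^sup>2)' = 5 x\<^sup>6 - 11 d\<^sup>2 x\<^sup>4 + 7 d\<^sup>4 x\<^sup>2 - d\<^sup>6\<close>.\<close>
  let ?Q = "Polynomial.smult (5/7) (x ^ 7) - Polynomial.smult (11/5 * d\<^sup>2) (x ^ 5)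
    + Polynomial.smult (7/3 * d ^ 4) (x ^ 3) - Polynomial.smult (d ^ 6) x"
  have f: "f = x * x - [:d\<^sup>2:]" using x_square by (simp add: d_def)
  have pf: "pderiv f = x + x" by (simp add: f pderiv_diff pderiv_mult pderiv_pCons)
  \<comment> \<open>Equality is checked on values, so that only arithmetic in the number x(t)
    remains.\<close>
  have "poly (f * pderiv (f * (x * f))) t = poly (pderiv ?Q) t" for t
  proof -
    have ft: "poly f t = (poly x t)\<^sup>2 - d\<^sup>2" by (simp add: f power2_eq_square)
    have Qt: "poly (pderiv ?Q) t = 5 * poly x t ^ 6 - 11 * d\<^sup>2 * poly x t ^ 4
        + 7 * d ^ 4 * (poly x t)\<^sup>2 - d ^ 6"
      by (simp add: pderiv_diff pderiv_add pderiv_smult pderiv_power)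
    show ?thesis
      unfolding Qt by (simp add: pderiv_mult pf ft algebra_simps eval_nat_numeral)
  qed
  then have "f * pderiv (f * (x * f)) = pderiv ?Q"
    by (intro poly_eq_poly_eq_iff[THEN iffD1] ext)
  then have "poly_integral a1 a2 (f * pderiv (f * (x * f))) = poly ?Q a2 - poly ?Q a1"
    by (simp only: poly_integral_pderiv)
  also have "poly x a1 = - d" "poly x a2 = d" by (simp_all add: poly_x d_def)
  \<comment> \<open>Since \<open>?Q\<close> is odd in x, the difference is twice its value at x = d,
    and 5/7 - 11/5 + 7/3 - 1 = -16/105.\<close>
  then have "poly ?Q a2 - poly ?Q a1 = - (32/105) * d ^ 7"
    by (simp add: algebra_simps eval_nat_numeral)
  finally show ?thesis using distinct by (simp add: d_def)
qed

text \<open>At the two points f' takes opposite values while (xf)' takes equal ones, so the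
  determinant is -(a2 - a1)^3. The product x f^2 has double zeros there, so its derivative
  vanishes.\<close>

lemma tangent_values:
  "poly (pderiv f) a1 * poly (pderiv (x * f)) a2 - poly (pderiv f) a2 * poly (pderiv (x * f)) a1 \<noteq> 0"
  "poly (pderiv (f * (x * f))) a1 = 0" "poly (pderiv (f * (x * f))) a2 = 0"
proof -
  have f': "poly (pderiv f) a1 = - (a2 - a1)" "poly (pderiv f) a2 = a2 - a1"
    by (simp_all add: f_eq pderiv_mult pderiv_pCons)
  have xf': "poly (pderiv (x * f)) a1 = (a2 - a1)\<^sup>2 / 2" "poly (pderiv (x * f)) a2 = (a2 - a1)\<^sup>2 / 2"
    unfolding pderiv_mult poly_add poly_mult f' poly_x by (simp_all add: power2_eq_square field_simps)
  show "poly (pderiv f) a1 * poly (pderiv (x * f)) a2 - poly (pderiv f) a2 * poly (pderiv (x * f)) a1 \<noteq> 0"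
    "poly (pderiv (f * (x * f))) a1 = 0" "poly (pderiv (f * (x * f))) a2 = 0"
    unfolding f' xf' using distinct by (simp_all add: pderiv_mult)
qed

text \<open>Independence is triangular: \<open>g\<close> is nonzero on w_1, while \<open>h\<close>
  kills w_1 but not w_0. Spanning comes from \<open>b_mem\<close>.\<close>

lemma dim_HC1:
  "vectorspace.fin_dim complex_field (HC1 complex_field A) \<and>
   vectorspace.dim complex_field (HC1 complex_field A) = 2"
proof -
  let ?H = "HC1 complex_field A"
  interpret V: vectorspace complex_field ?H
    by (rule HC1_is_vectorspace) (rule class_field, rule algebra_axioms)
  interpret b: nodal_bracket A ?H "HC1_class complex_field A" f x "(a1 + a2) / 2" "((a2 - a1) / 2)\<^sup>2"
    by (intro nodal_bracket.intro nodal_bracket_axioms.intro cyclic_bracket_HC1_class algebra_axioms A_eq x_square x_def)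
  let ?w0 = "HC1_class complex_field A f (x * f)"
  let ?w1 = "HC1_class complex_field A f (f * (x * f))"
  have fA: "f \<in> carrier A" and xfA: "x * f \<in> carrier A" and fxfA: "f * (x * f) \<in> carrier A"
    using b.A_v b.A_u by (auto simp: b.v_def[symmetric])
  have w: "?w0 \<in> carrier ?H" "?w1 \<in> carrier ?H"
    using fA xfA fxfA by auto
  obtain g where g: "mod_hom complex_field ?H scalar_module g"
    and g_class: "\<And>p q. \<lbrakk>p \<in> carrier A; q \<in> carrier A\<rbrakk> \<Longrightarrow>
      g (HC1_class complex_field A p q) = poly_integral a1 a2 (p * pderiv q)"
    by (rule cyclic_bracket.HC1_lift[OF cyclic_bracket_integral]) (rule that)
  obtain h where h: "mod_hom complex_field ?H scalar_module h"
    and h_class: "\<And>p q. \<lbrakk>p \<in> carrier A; q \<in> carrier A\<rbrakk> \<Longrightarrow>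
      h (HC1_class complex_field A p q) = poly (pderiv p) a1 * poly (pderiv q) a2 - poly (pderiv p) a2 * poly (pderiv q) a1"
    by (rule cyclic_bracket.HC1_lift[OF cyclic_bracket_tangent]) (rule that)
  interpret g: mod_hom complex_field ?H scalar_module g by (rule g)
  interpret h: mod_hom complex_field ?H scalar_module h by (rule h)
  \<comment> \<open>Starting from the empty independent set, a vector is added when some functional
    vanishes on the span so far but not on the vector.\<close>
  have "V.span {} \<subseteq> g.ker"
    by (rule V.span_is_subset[OF _ g.ker_is_submodule]) simp
  moreover have "?w1 \<notin> g.ker"
    using fA fxfA integral_nonzero by (simp add: g.ker_def g_class)
  ultimately have "?w1 \<notin> V.span {}" by blast
  moreover have "V.lin_indpt {}" by (simp add: V.lin_dep_def)
  ultimately have indpt1: "V.lin_indpt {?w1}"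
    using V.lin_dep_iff_in_span[of "{}" ?w1] w by simp
  have w1: "?w1 \<in> h.ker"
    using w fA fxfA tangent_values by (simp add: h.ker_def h_class)
  then have "V.span {?w1} \<subseteq> h.ker"
    by (intro V.span_is_subset[OF _ h.ker_is_submodule]) simp
  moreover have w0: "?w0 \<notin> h.ker"
    using fA xfA tangent_values by (simp add: h.ker_def h_class)
  ultimately have "?w0 \<notin> V.span {?w1}" by blast
  moreover have ne: "?w0 \<noteq> ?w1" using w0 w1 by metis
  ultimately have indpt: "V.lin_indpt {?w1, ?w0}"
    using V.lin_dep_iff_in_span[of "{?w1}" ?w0] w indpt1 by (simp add: insert_commute)
  \<comment> \<open>The submodule of the reduction is now the span of w_0 and w_1. It contains all
    classes, which generate HC_1.\<close>
  let ?S = "V.span {?w1, ?w0}"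
  have S: "submodule complex_field ?S ?H"
    using w by (intro V.span_is_submodule) simp
  interpret S: nodal_bracket_submodule A ?H "HC1_class complex_field A" f x "(a1 + a2) / 2" "((a2 - a1) / 2)\<^sup>2" ?S
    by (intro nodal_bracket_submodule.intro b.nodal_bracket_axioms S)
  have "{?w1, ?w0} \<subseteq> ?S" using w by (intro V.in_own_span) simp
  then have "?w0 \<in> ?S" "?w1 \<in> ?S" by (simp_all only: insert_subset)
  then have "HC1_class complex_field A p q \<in> ?S" if "p \<in> carrier A" "q \<in> carrier A" for p q
    using that by (rule S.b_mem[unfolded b.v_def])
  then have gen: "?S = carrier ?H"
    by (rule HC1_generated[OF algebra_axioms S])
  have "V.basis {?w1, ?w0}"
    using indpt gen w by (simp add: V.basis_def)
  then have "V.dim = 2"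
    using V.dim_basis[of "{?w1, ?w0}"] ne by (simp add: card_insert_if)
  moreover have "V.fin_dim"
    unfolding V.fin_dim_def using gen w by (intro exI[of _ "{?w1, ?w0}"]) simp
  ultimately show ?thesis by simp
qed

end

theorem proposition5p3p2:
  fixes a1 a2 :: complex and f :: "complex poly" and I :: "complex poly set"
    and A :: "(complex, complex poly) module"
  assumes "a1 \<noteq> a2"
    and "f = [:- a1, 1:] * [:- a2, 1:]"
    and "I = Idl\<^bsub>poly_algebra\<^esub> {f}"
    and "A = scalars_plus_ideal I"
  shows "vectorspace.fin_dim complex_field (HC1 complex_field A) \<and>
         vectorspace.dim complex_field (HC1 complex_field A) = 2"
proof -
  interpret nodal_curve a1 a2 f A
    using assms by unfold_locales simp_all
  show ?thesis by (rule dim_HC1)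
qed

end
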